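(* Let $m\in\mathbb{N}$ and let $p_1,\ldots,p_m$ be minimal idempotents in $(\beta\mathbb{N},+)$. Then for every $A\in\bigotimes_{i=1}^m p_i$ and every $T\in\mathcal{P}_f(\mathbb{P})$ there exist functions $\alpha_1,\ldots,\alpha_m:\mathcal{P}_f(\mathbb{N}^{\mathbb{N}})\to\mathbb{N}$ and $H_1,\ldots,H_m:\mathcal{P}_f(\mathbb{N}^{\mathbb{N}})\to\mathcal{P}_f(\mathbb{N})$ such that (1) if $G,K\in\mathcal{P}_f(\mathbb{N}^{\mathbb{N}})$ and $G\subsetneq K$, then $H_i(G)<H_i(K)$ for every $i\in\{1,\ldots,m\}$; and (2) if $G_1\subsetneq G_2\subsetneq\cdots\subsetneq G_n\subsetneq\cdots$ is an infinite sequence in $\mathcal{P}_f(\mathbb{N}^{\mathbb{N}})$, then for all $\beta_1<\beta_2<\cdots<\beta_m$ in $\mathcal{P}_f(\mathbb{N})$, all $f_i\in G_i$ ($i\in\mathbb{N}$), and all $P_1,\ldots,P_m\in T$, $$\left(\sum_{i\in\beta_1}\alpha_1(G_i)+P_1\Bigl(\sum_{i\in\beta_1}\sum_{t\in H_1(G_i)}f_i(t)\Bigr),\ldots,\sum_{i\in\beta_m}\alpha_m(G_i)+P_m\Bigl(\sum_{i\in\beta_m}\sum_{t\in H_m(G_i)}f_i(t)\Bigr)\right)\in A.$$ In fact, the same holds for arbitrary idempotents $p_1,\ldots,p_m$ of $(\mathcal{J}_p,+)$ (in place of minimal idempotents).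
   Context: $\mathbb{N}$ is the set of positive integers; $\mathcal{P}_f(X)$ is the set of nonempty finite subsets of $X$; $\mathbb{N}^{\mathbb{N}}$ is the set of all functions $\mathbb{N}\to\mathbb{N}$. For $\beta,\gamma\in\mathcal{P}_f(\mathbb{N})$, $\beta<\gamma$ means $\max\beta<\min\gamma$. $\mathbb{P}$ is the set of one-variable polynomials with integer coefficients and zero constant term. $\beta\mathbb{N}$ is the set of ultrafilters on $\mathbb{N}$, with the Stone topology and the operation: $A\in p+q$ iff $\{x\in\mathbb{N}:-x+A\in q\}\in p$, where $-x+A=\{y\in\mathbb{N}:x+y\in A\}$. An ultrafilter $p$ is idempotent if $p+p=p$; a minimal idempotent is an idempotent lying in $K(\beta\mathbb{N},+)$, the smallest two-sided ideal (the union of all minimal left ideals) of $(\beta\mathbb{N},+)$. A set $A\subseteq\mathbb{N}$ is a $J_p$-set if for every $F\in\mathcal{P}_f(\mathbb{P})$ and every $H\in\mathcal{P}_f(\mathbb{N}^{\mathbb{N}})$ there exist $a\in\mathbb{N}$ and $\beta\in\mathcal{P}_f(\mathbb{N})$ such that $a+P(\sum_{t\in\beta}f(t))\in A$ for all $P\in F$ and $f\in H$. $\mathcal{J}_p=\{q\in\beta\mathbb{N}:\text{every }A\in q\text{ is a }J_p\text{-set}\}$ (the subscript $p$ stands for "polynomial" and is not an ultrafilter); it is a two-sided ideal of $(\beta\mathbb{N},+)$. Tensor products: for ultrafilters $p_1,\ldots,p_k$ on $\mathbb{N}$, $\bigotimes_{i=1}^k p_i$ is the ultrafilter on $\mathbb{N}^k$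 defined recursively by $\bigotimes_{i=1}^1p_i=p_1$, and, for $A\subseteq\mathbb{N}^{k+1}$, $A\in\bigotimes_{i=1}^{k+1}p_i$ iff $\{(x_1,\ldots,x_k)\in\mathbb{N}^k:\{x_{k+1}\in\mathbb{N}:(x_1,\ldots,x_{k+1})\in A\}\in p_{k+1}\}\in\bigotimes_{i=1}^kp_i$. *)

theory Defs
  imports "HOL-Library.FuncSet" "HOL-Computational_Algebra.Polynomial"
begin

abbreviation Npos :: "nat set" where
  "Npos \<equiv> {1..}"

text \<open>Elements are extensional functions (constant outside \<open>Npos\<close>), so that equality and
  proper inclusion of sets of functions have their usual meaning.\<close>

abbreviation NN :: "(nat \<Rightarrow> nat) set" where
  "NN \<equiv> Npos \<rightarrow>\<^sub>E Npos"

definition Pf :: "'a set \<Rightarrow> 'a set set" where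
  "Pf X = {F. F \<subseteq> X \<and> finite F \<and> F \<noteq> {}}"

definition set_less :: "nat set \<Rightarrow> nat set \<Rightarrow> bool" (infix "\<lless>" 50) where
  "\<beta> \<lless> \<gamma> \<longleftrightarrow> Max \<beta> < Min \<gamma>"

definition Polys0 :: "int poly set" where
  "Polys0 = {P. coeff P 0 = 0}"

definition ultrafilter_on :: "'a set \<Rightarrow> 'a set set \<Rightarrow> bool" where
  "ultrafilter_on X p \<longleftrightarrow>
     p \<subseteq> Pow X \<and> X \<in> p \<and> {} \<notin> p \<and>
     (\<forall>A\<in>p. \<forall>B\<in>p. A \<inter> B \<in> p) \<and>
     (\<forall>A\<in>p. \<forall>B. A \<subseteq> B \<and> B \<subseteq> X \<longrightarrow> B \<in> p) \<and>
     (\<forall>A. A \<subseteq> X \<longrightarrow> A \<in> p \<or> X - A \<in> p)"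

definition betaN :: "nat set set set" where
  "betaN = {p. ultrafilter_on Npos p}"

definition usum :: "nat set set \<Rightarrow> nat set set \<Rightarrow> nat set set" (infixl "\<oplus>" 65) where
  "p \<oplus> q = {A. A \<subseteq> Npos \<and> {x \<in> Npos. {y \<in> Npos. x + y \<in> A} \<in> q} \<in> p}"

definition two_sided_ideal :: "nat set set set \<Rightarrow> bool" where
  "two_sided_ideal I \<longleftrightarrow>
     I \<subseteq> betaN \<and> I \<noteq> {} \<and> (\<forall>p\<in>I. \<forall>q\<in>betaN. p \<oplus> q \<in> I \<and> q \<oplus> p \<in> I)"

text \<open>The smallest two-sided ideal of \<open>betaN\<close>.\<close>

definition K_betaN :: "nat set set set" where
  "K_betaN = \<Inter> {I. two_sided_ideal I}"

definition minimal_idempotent :: "nat set set \<Rightarrow> bool" where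
  "minimal_idempotent p \<longleftrightarrow> p \<in> K_betaN \<and> p \<oplus> p = p"

text \<open>A polynomial may take nonpositive values, so \<open>a + P(s)\<close> is computed in the integers.\<close>

definition Jp_set :: "nat set \<Rightarrow> bool" where
  "Jp_set A \<longleftrightarrow> A \<subseteq> Npos \<and>
     (\<forall>F \<in> Pf Polys0. \<forall>H \<in> Pf NN.
        \<exists>a \<in> Npos. \<exists>\<beta> \<in> Pf Npos. \<forall>P\<in>F. \<forall>f\<in>H.
          int a + poly P (int (\<Sum>t\<in>\<beta>. f t)) \<in> int ` A)"

definition Jp :: "nat set set set" where
  "Jp = {q \<in> betaN. \<forall>A\<in>q. Jp_set A}"

text \<open>A \<open>k\<close>-tuple is an extensional function on \<open>{1..k}\<close>.\<close>

abbreviation tuples :: "nat \<Rightarrow> (nat \<Rightarrow> nat) set" where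
  "tuples k \<equiv> {1..k} \<rightarrow>\<^sub>E Npos"

text \<open>The tensor product of \<open>p 1, \<dots>, p k\<close>. The recursion is started at \<open>k = 0\<close>, with the unique
  ultrafilter on the one-point set \<open>tuples 0\<close>; lemma \<open>tensor_1\<close> gives the usual start.\<close>

primrec tensor :: "(nat \<Rightarrow> nat set set) \<Rightarrow> nat \<Rightarrow> (nat \<Rightarrow> nat) set set" where
  "tensor p 0 = {tuples 0}"
| "tensor p (Suc k) =
     {A. A \<subseteq> tuples (Suc k) \<and>
         {x \<in> tuples k. {y \<in> Npos. x(Suc k := y) \<in> A} \<in> p (Suc k)} \<in> tensor p k}"

lemma tensor_1:
  "tensor p 1 = {A. A \<subseteq> tuples 1 \<and> {y \<in> Npos. (\<lambda>i\<in>{1..1}. y) \<in> A} \<in> p 1}"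
proof -
  have upd: "(\<lambda>_. undefined)(Suc 0 := y) = (\<lambda>i\<in>{1..1}. y)" for y :: nat
    by (auto simp: restrict_def)
  have tup: "tuples 0 = {\<lambda>_. undefined}"
    by simp
  have one: "{x \<in> {z}. Q x} \<in> {{z}} \<longleftrightarrow> Q z" for Q and z :: "nat \<Rightarrow> nat"
    by blast
  show ?thesis
    unfolding One_nat_def tensor.simps tup[unfolded One_nat_def] one upd[unfolded One_nat_def]
    by (rule refl)
qed

end

theory Submission
  imports Defs "HOL-Library.Multiset"
begin

text \<open>
  A polynomial van der Waerden theorem for finite sums (polynomials along \<open>\<Sum>t\<in>\<beta>. f t\<close>, several
  \<open>f\<close> at once) is obtained by colour focusing and PET induction. It says that \<open>Npos\<close> is not a
  finite union of non-\<open>J\<^sub>p\<close> sets, so \<open>Jp\<close> is nonempty; being a two-sided ideal, it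
  contains \<open>K_betaN\<close> and hence all minimal idempotents.

  For idempotents in \<open>Jp\<close>, unfold \<open>A\<close> into a tree whose fibres over a node of level \<open>j\<close> are members of
  \<open>p (j + 1)\<close>, and choose \<open>\<alpha> j G\<close>, \<open>H j G\<close> by recursion on the finite set \<open>G\<close>. Only finitely many
  partial sums arise from chains below \<open>G\<close>. Such a sum \<open>a + P(s)\<close> lies in a starred fibre \<open>B\<^sup>*\<close>, and as
  \<open>P(s + t) = P(s) + Q(t)\<close> with \<open>Q\<close> again in \<open>Polys0\<close>, one application of the \<open>J\<^sub>p\<close> property to the
  intersection of the finitely many translates \<open>- (a + P(s)) + B\<^sup>*\<close> extends all of them.
\<close>

section \<open>Polynomial functions of finite sets\<close>

text \<open>\<open>vip_deg d v\<close>: \<open>v\<close> has degree at most \<open>d\<close> and no constant term. Removing \<open>\<gamma>\<close> from the argument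
  keeps the derivative a total function; only arguments disjoint from \<open>\<gamma>\<close> matter.\<close>

definition set_deriv :: "nat set \<Rightarrow> (nat set \<Rightarrow> int) \<Rightarrow> nat set \<Rightarrow> int" where
  "set_deriv \<gamma> v = (\<lambda>\<beta>. v (\<gamma> \<union> \<beta>) - v \<gamma> - v (\<beta> - \<gamma>))"

primrec vip_deg :: "nat \<Rightarrow> (nat set \<Rightarrow> int) \<Rightarrow> bool" where
  "vip_deg 0 v \<longleftrightarrow> (\<forall>\<beta>. finite \<beta> \<longrightarrow> v \<beta> = 0)"
| "vip_deg (Suc d) v \<longleftrightarrow> (\<forall>\<gamma>. finite \<gamma> \<longrightarrow> vip_deg d (set_deriv \<gamma> v))"

lemma vip_deg_cong:
  assumes "\<And>\<beta>. finite \<beta> \<Longrightarrow> v \<beta> = w \<beta>"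
  shows "vip_deg d v \<longleftrightarrow> vip_deg d w"
  using assms
proof (induction d arbitrary: v w)
  case (Suc d)
  have "vip_deg d (set_deriv \<gamma> v) \<longleftrightarrow> vip_deg d (set_deriv \<gamma> w)" if "finite \<gamma>" for \<gamma>
    by (rule Suc.IH) (simp add: set_deriv_def Suc.prems that)
  then show ?case by simp
qed simp

lemma vip_deg_diff: "vip_deg d v \<Longrightarrow> vip_deg d w \<Longrightarrow> vip_deg d (\<lambda>\<beta>. v \<beta> - w \<beta>)"
proof (induction d arbitrary: v w)
  case (Suc d)
  have "set_deriv \<gamma> (\<lambda>\<beta>. v \<beta> - w \<beta>) = (\<lambda>\<beta>. set_deriv \<gamma> v \<beta> - set_deriv \<gamma> w \<beta>)" for \<gamma>
    by (simp add: set_deriv_def fun_eq_iff)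
  then show ?case using Suc by simp
qed simp

lemma vip_deg_add: "vip_deg d v \<Longrightarrow> vip_deg d w \<Longrightarrow> vip_deg d (\<lambda>\<beta>. v \<beta> + w \<beta>)"
proof (induction d arbitrary: v w)
  case (Suc d)
  have "set_deriv \<gamma> (\<lambda>\<beta>. v \<beta> + w \<beta>) = (\<lambda>\<beta>. set_deriv \<gamma> v \<beta> + set_deriv \<gamma> w \<beta>)" for \<gamma>
    by (simp add: set_deriv_def fun_eq_iff)
  then show ?case using Suc by simp
qed simp

lemma vip_deg_Suc: "vip_deg d v \<Longrightarrow> vip_deg (Suc d) v"
proof (induction d arbitrary: v)
  case 0
  then show ?case by (simp add: set_deriv_def)
qed simp

lemma vip_deg_mono: "vip_deg d v \<Longrightarrow> d \<le> e \<Longrightarrow> vip_deg e v"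
  by (induction e rule: nat_induct) (auto simp: le_Suc_eq simp del: vip_deg.simps intro: vip_deg_Suc)

text \<open>The derivative along \<open>{}\<close> takes the value \<open>- v {}\<close> at
  \<open>{}\<close>, so the claim passes down to degree \<open>0\<close>.\<close>

lemma vip_deg_empty: "vip_deg d v \<Longrightarrow> v {} = 0"
proof (induction d arbitrary: v)
  case (Suc d)
  then have "set_deriv {} v {} = 0" by simp
  then show ?case by (simp add: set_deriv_def)
qed simp

section \<open>Colour focusing and PET induction\<close>

text \<open>The bounds \<open>D\<close> and \<open>\<Gamma>\<close>, uniform over all colourings, make it possible to recolour the
  integers by finite blocks.\<close>

definition recurrent :: "(nat set \<Rightarrow> int) set \<Rightarrow> bool" where
  "recurrent V \<longleftrightarrow> (\<forall>k M. \<exists>D \<Gamma>. finite D \<and> finite \<Gamma> \<and>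
     (\<forall>\<beta>\<in>\<Gamma>. finite \<beta> \<and> \<beta> \<noteq> {} \<and> \<beta> \<subseteq> {M<..}) \<and>
     (\<forall>c :: int \<Rightarrow> nat. (\<forall>n. c n < k) \<longrightarrow>
        (\<exists>a\<in>D. \<exists>\<beta>\<in>\<Gamma>. \<forall>v\<in>V. c (a + v \<beta>) = c a)))"

lemma recurrentE:
  assumes "recurrent V"
  obtains D \<Gamma> where "finite D" "finite \<Gamma>" "\<forall>\<beta>\<in>\<Gamma>. finite \<beta> \<and> \<beta> \<noteq> {} \<and> \<beta> \<subseteq> {M<..}"
    "\<And>c :: int \<Rightarrow> nat. \<forall>n. c n < k \<Longrightarrow> \<exists>a\<in>D. \<exists>\<beta>\<in>\<Gamma>. \<forall>v\<in>V. c (a + v \<beta>) = c a"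
  using assms[unfolded recurrent_def, THEN spec[of _ k], THEN spec[of _ M]]
  by (elim exE conjE) (use that in blast)

text \<open>The spokes of colour focusing: all the monochromatic configurations share the base point
  \<open>a\<close>, so once the colour of \<open>a\<close> lies in \<open>C\<close>, one of them has
  the same colour as \<open>a\<close>.\<close>

definition focused :: "(nat set \<Rightarrow> int) set \<Rightarrow> (int \<Rightarrow> nat) \<Rightarrow> int \<Rightarrow> nat set set \<Rightarrow> nat set \<Rightarrow> bool" where
  "focused V c a \<Gamma> C \<longleftrightarrow> (\<forall>col\<in>C. \<exists>\<beta>\<in>\<Gamma>. \<forall>v\<in>V. c (a + v \<beta>) = col)"

text \<open>Only finitely many colour patterns occur on a window \<open>m + E\<close>, and numbering
  them gives a colour for \<open>m\<close>. The number \<open>k'\<close> depends on \<open>E\<close>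
  and \<open>k\<close> alone, so the uniform bounds in \<open>recurrent\<close> can be taken before
  \<open>c\<close> is known.\<close>

lemma block_colouring:
  fixes c :: "int \<Rightarrow> nat"
  assumes "finite E"
  obtains k' where "\<And>c :: int \<Rightarrow> nat. \<forall>n. c n < k \<Longrightarrow>
    \<exists>c' :: int \<Rightarrow> nat. (\<forall>n. c' n < k') \<and> (\<forall>m m'. c' m = c' m' \<longrightarrow> (\<forall>e\<in>E. c (m + e) = c (m' + e)))"
proof -
  let ?X = "E \<rightarrow>\<^sub>E {..<k}"
  have "finite ?X" using assms by (intro finite_PiE) auto
  then obtain h where h: "bij_betw h ?X {0..<card ?X}"
    using ex_bij_betw_finite_nat by blast
  show ?thesis
  proof (rule that)
    fix c :: "int \<Rightarrow> nat" assume c: "\<forall>n. c n < k"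
    define c' where "c' m = h (\<lambda>e\<in>E. c (m + e))" for m
    have X: "(\<lambda>e\<in>E. c (m + e)) \<in> ?X" for m using c by auto
    have "c' m < card ?X" for m
      using bij_betwE[OF h] X unfolding c'_def by auto
    moreover have "c (m + e) = c (m' + e)" if eq: "c' m = c' m'" and "e \<in> E" for m m' e
    proof -
      have "(\<lambda>e\<in>E. c (m + e)) = (\<lambda>e\<in>E. c (m' + e))"
        using eq X bij_betw_imp_inj_on[OF h] unfolding c'_def by (meson inj_onD)
      then show ?thesis using \<open>e \<in> E\<close> by (metis restrict_apply')
    qed
    ultimately show "\<exists>c' :: int \<Rightarrow> nat. (\<forall>n. c' n < card ?X) \<and>
        (\<forall>m m'. c' m = c' m' \<longrightarrow> (\<forall>e\<in>E. c (m + e) = c (m' + e)))" by blast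
  qed
qed

text \<open>If blocks at \<open>m\<close> and at \<open>m + (v \<beta> - u \<beta> + set_deriv \<gamma> v \<beta>)\<close> look alike, then a configuration
  focused at \<open>a\<close> inside the block yields, via \<open>\<gamma> \<union> \<beta>\<close>, one focused at \<open>a + m - u \<beta>\<close>, and \<open>\<beta>\<close> itself
  contributes the further colour of \<open>m + a\<close>.\<close>

lemma recurrent_step:
  fixes V :: "(nat set \<Rightarrow> int) set"
  assumes V: "finite V" "u \<in> V" "\<And>v. v \<in> V \<Longrightarrow> v {} = 0"
    and IH: "\<And>\<Gamma>. finite \<Gamma> \<Longrightarrow> (\<And>\<gamma>. \<gamma> \<in> \<Gamma> \<Longrightarrow> finite \<gamma>) \<Longrightarrow>
      recurrent ((\<lambda>(v, \<gamma>) \<beta>. v \<beta> - u \<beta> + set_deriv \<gamma> v \<beta>) ` (V \<times> \<Gamma>))"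
  shows "recurrent V"
  unfolding recurrent_def
proof (intro allI)
  fix k M :: nat
  let ?nice = "\<lambda>\<Gamma>. finite \<Gamma> \<and> (\<forall>\<beta>\<in>\<Gamma>. finite \<beta> \<and> \<beta> \<noteq> {} \<and> \<beta> \<subseteq> {M<..})"
  let ?good = "\<lambda>c :: int \<Rightarrow> nat. \<lambda>D \<Gamma>. \<exists>a\<in>D. \<exists>\<beta>\<in>\<Gamma>. \<forall>v\<in>V. c (a + v \<beta>) = c a"
  \<comment> \<open>Induction on the number \<open>r\<close> of focused colours, all different from
    the colour of the base point. For \<open>r = k\<close> no colour is left for the base
    point.\<close>
  have "\<exists>D \<Gamma>. finite D \<and> ?nice \<Gamma> \<and> (\<forall>c :: int \<Rightarrow> nat. (\<forall>n. c n < k) \<longrightarrow>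
      ?good c D \<Gamma> \<or> (\<exists>a\<in>D. \<exists>C. C \<subseteq> {..<k} \<and> card C = r \<and> c a \<notin> C \<and> focused V c a \<Gamma> C))" for r
  proof (induction r)
    case 0
    show ?case
      by (rule exI[of _ "{0}"], rule exI[of _ "{}"]) (auto simp: focused_def)
  next
    case (Suc r)
    then obtain D \<Gamma> where D: "finite D" and \<Gamma>: "?nice \<Gamma>"
      and DG: "\<And>c :: int \<Rightarrow> nat. \<forall>n. c n < k \<Longrightarrow>
        ?good c D \<Gamma> \<or> (\<exists>a\<in>D. \<exists>C. C \<subseteq> {..<k} \<and> card C = r \<and> c a \<notin> C \<and> focused V c a \<Gamma> C)"
      by blast
    \<comment> \<open>The empty set makes \<open>E\<close> contain each \<open>a\<close> itself,
      because \<open>v {} = 0\<close>. The case \<open>\<gamma> = {}\<close> of \<open>shift\<close>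
      is the one that yields the new colour.\<close>
    define \<Gamma>0 where "\<Gamma>0 = insert {} \<Gamma>"
    define E where "E = (\<lambda>(a, v, \<gamma>). a + v \<gamma>) ` (D \<times> V \<times> \<Gamma>0)"
    have \<Gamma>0: "finite \<Gamma>0" "\<And>\<gamma>. \<gamma> \<in> \<Gamma>0 \<Longrightarrow> finite \<gamma>" using \<Gamma> by (auto simp: \<Gamma>0_def)
    have "finite E" unfolding E_def using D V(1) \<Gamma>0 by auto
    then obtain k' where k': "\<And>c :: int \<Rightarrow> nat. \<forall>n. c n < k \<Longrightarrow>
      \<exists>c' :: int \<Rightarrow> nat. (\<forall>n. c' n < k') \<and> (\<forall>m m'. c' m = c' m' \<longrightarrow> (\<forall>e\<in>E. c (m + e) = c (m' + e)))"
      using block_colouring[of E k] by metis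
    \<comment> \<open>Sets beyond \<open>M'\<close> are disjoint from every member of
      \<open>\<Gamma>\<close>, which gives \<open>\<beta> - \<gamma> = \<beta>\<close> in
      \<open>shift\<close>.\<close>
    define M' where "M' = Max (insert M (\<Union>\<Gamma>))"
    have fin: "finite (insert M (\<Union>\<Gamma>))" using \<Gamma> by auto
    have M': "M \<le> M'" "\<And>\<gamma> x. \<gamma> \<in> \<Gamma> \<Longrightarrow> x \<in> \<gamma> \<Longrightarrow> x \<le> M'"
      unfolding M'_def using fin by (auto intro!: Max_ge)
    have IH0: "recurrent ((\<lambda>(v, \<gamma>) \<beta>. v \<beta> - u \<beta> + set_deriv \<gamma> v \<beta>) ` (V \<times> \<Gamma>0))"
      by (rule IH) (use \<Gamma>0 in auto)
    obtain D2 \<Gamma>2 where D2: "finite D2" and \<Gamma>2: "finite \<Gamma>2"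
        "\<forall>\<beta>\<in>\<Gamma>2. finite \<beta> \<and> \<beta> \<noteq> {} \<and> \<beta> \<subseteq> {M'<..}"
      and DG2: "\<And>c :: int \<Rightarrow> nat. \<forall>n. c n < k' \<Longrightarrow> \<exists>m\<in>D2. \<exists>\<beta>\<in>\<Gamma>2.
          \<forall>b\<in>(\<lambda>(v, \<gamma>) \<beta>. v \<beta> - u \<beta> + set_deriv \<gamma> v \<beta>) ` (V \<times> \<Gamma>0). c (m + b \<beta>) = c m"
      by (rule recurrentE[OF IH0, of M' k']) (rule that; assumption)
    define D3 where "D3 = (\<lambda>(a, m, \<beta>). a + m - u \<beta>) ` (D \<times> D2 \<times> \<Gamma>2) \<union> (\<lambda>(a, m). a + m) ` (D \<times> D2)"
    define \<Gamma>3 where "\<Gamma>3 = \<Gamma> \<union> \<Gamma>2 \<union> (\<lambda>(\<gamma>, \<beta>). \<gamma> \<union> \<beta>) ` (\<Gamma> \<times> \<Gamma>2)"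
    have "finite D3" unfolding D3_def using D D2 \<Gamma>2 by auto
    moreover have "?nice \<Gamma>3"
    proof -
      have n1: "finite \<beta> \<and> \<beta> \<noteq> {} \<and> \<beta> \<subseteq> {M<..}" if "\<beta> \<in> \<Gamma>" for \<beta>
        using \<Gamma> that by blast
      have n2: "finite \<beta> \<and> \<beta> \<noteq> {} \<and> \<beta> \<subseteq> {M<..}" if "\<beta> \<in> \<Gamma>2" for \<beta>
      proof -
        have "{M'<..} \<subseteq> {M<..}" using M'(1) by simp
        then show ?thesis using bspec[OF \<Gamma>2(2) that] by (meson order_trans)
      qed
      have n3: "finite (\<gamma> \<union> \<beta>) \<and> \<gamma> \<union> \<beta> \<noteq> {} \<and> \<gamma> \<union> \<beta> \<subseteq> {M<..}"
        if "\<gamma> \<in> \<Gamma>" "\<beta> \<in> \<Gamma>2" for \<gamma> \<beta>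
        using n1[OF that(1)] n2[OF that(2)] by simp
      have "finite \<Gamma>3" using \<Gamma> \<Gamma>2(1) unfolding \<Gamma>3_def by simp
      moreover have "finite \<beta> \<and> \<beta> \<noteq> {} \<and> \<beta> \<subseteq> {M<..}" if "\<beta> \<in> \<Gamma>3" for \<beta>
      proof -
        consider "\<beta> \<in> \<Gamma>" | "\<beta> \<in> \<Gamma>2" | \<gamma> \<delta> where "\<gamma> \<in> \<Gamma>" "\<delta> \<in> \<Gamma>2" "\<beta> = \<gamma> \<union> \<delta>"
          using \<open>\<beta> \<in> \<Gamma>3\<close> unfolding \<Gamma>3_def by blast
        then show ?thesis using n1 n2 n3 by cases simp_all
      qed
      ultimately show ?thesis by blast
    qed
    moreover have "?good c D3 \<Gamma>3 \<or>
        (\<exists>a\<in>D3. \<exists>C. C \<subseteq> {..<k} \<and> card C = Suc r \<and> c a \<notin> C \<and> focused V c a \<Gamma>3 C)"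
      if c: "\<forall>n. c n < k" for c :: "int \<Rightarrow> nat"
    proof -
      obtain c' :: "int \<Rightarrow> nat" where c': "\<forall>n. c' n < k'"
        "\<And>m m' e. c' m = c' m' \<Longrightarrow> e \<in> E \<Longrightarrow> c (m + e) = c (m' + e)"
        using k'[OF c] by blast
      obtain m \<beta> where m: "m \<in> D2" and \<beta>: "\<beta> \<in> \<Gamma>2"
        and "\<forall>b\<in>(\<lambda>(v, \<gamma>) \<beta>. v \<beta> - u \<beta> + set_deriv \<gamma> v \<beta>) ` (V \<times> \<Gamma>0). c' (m + b \<beta>) = c' m"
        using DG2[OF c'(1)] by blast
      then have mono: "c' (m + (v \<beta> - u \<beta> + set_deriv \<gamma> v \<beta>)) = c' m" if "v \<in> V" "\<gamma> \<in> \<Gamma>0" for v \<gamma>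
        using that by force
      have shift: "c (a + m - u \<beta> + v (\<gamma> \<union> \<beta>)) = c (m + (a + v \<gamma>))"
        if "a \<in> D" "v \<in> V" "\<gamma> \<in> \<Gamma>0" for a v \<gamma>
      proof -
        have "\<beta> - \<gamma> = \<beta>"
          using \<Gamma>2(2) \<beta> M'(2) \<open>\<gamma> \<in> \<Gamma>0\<close> unfolding \<Gamma>0_def by fastforce
        then have eq: "a + m - u \<beta> + v (\<gamma> \<union> \<beta>) = m + (v \<beta> - u \<beta> + set_deriv \<gamma> v \<beta>) + (a + v \<gamma>)"
          by (simp add: set_deriv_def)
        have "a + v \<gamma> \<in> E" unfolding E_def using that by force
        then show ?thesis unfolding eq by (rule c'(2)[OF mono[OF that(2,3)]])
      qed
      \<comment> \<open>The induction hypothesis is applied to the translated colouring, so its base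
        point \<open>a\<close> stands for \<open>m + a\<close>.\<close>
      have cm: "\<forall>n. c (m + n) < k" using c by simp
      show ?thesis using DG[OF cm]
      proof
        assume "?good (\<lambda>n. c (m + n)) D \<Gamma>"
        then obtain a \<gamma> where a: "a \<in> D" "\<gamma> \<in> \<Gamma>" "\<forall>v\<in>V. c (m + (a + v \<gamma>)) = c (m + a)" by blast
        then have "\<forall>v\<in>V. c (a + m + v \<gamma>) = c (a + m)" by (simp add: ac_simps)
        moreover have "a + m \<in> D3" using a m by (auto simp: D3_def)
        ultimately show ?thesis using a(2) unfolding \<Gamma>3_def by blast
      next
        assume "\<exists>a\<in>D. \<exists>C. C \<subseteq> {..<k} \<and> card C = r \<and> c (m + a) \<notin> C \<and> focused V (\<lambda>n. c (m + n)) a \<Gamma> C"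
        then obtain a C where a: "a \<in> D" and C: "C \<subseteq> {..<k}" "card C = r" "c (m + a) \<notin> C"
          and foc: "\<And>col. col \<in> C \<Longrightarrow> \<exists>\<gamma>\<in>\<Gamma>. \<forall>v\<in>V. c (m + (a + v \<gamma>)) = col"
          unfolding focused_def by blast
        define a' where "a' = a + m - u \<beta>"
        define C' where "C' = insert (c (m + a)) C"
        have a'D: "a' \<in> D3" unfolding D3_def a'_def using a m \<beta> by force
        have "finite C" using C(1) finite_subset by blast
        then have C': "C' \<subseteq> {..<k}" "card C' = Suc r" using C c by (auto simp: C'_def)
        have foc': "focused V c a' \<Gamma>3 C'"
          unfolding focused_def
        proof
          fix col assume "col \<in> C'"
          then consider "col = c (m + a)" | "col \<in> C" by (auto simp: C'_def)
          then show "\<exists>\<beta>\<in>\<Gamma>3. \<forall>v\<in>V. c (a' + v \<beta>) = col"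
          proof cases
            case 1
            have "c (a' + v \<beta>) = col" if "v \<in> V" for v
              using shift[OF a that, of "{}"] V(3)[OF that] 1 by (simp add: \<Gamma>0_def a'_def)
            moreover have "\<beta> \<in> \<Gamma>3" using \<beta> by (simp add: \<Gamma>3_def)
            ultimately show ?thesis by blast
          next
            case 2
            then obtain \<gamma> where \<gamma>: "\<gamma> \<in> \<Gamma>" "\<forall>v\<in>V. c (m + (a + v \<gamma>)) = col" using foc by blast
            have "c (a' + v (\<gamma> \<union> \<beta>)) = col" if "v \<in> V" for v
              using shift[OF a that, of \<gamma>] \<gamma> that by (simp add: \<Gamma>0_def a'_def)
            moreover have "\<gamma> \<union> \<beta> \<in> \<Gamma>3" using \<beta> \<gamma> by (force simp: \<Gamma>3_def)
            ultimately show ?thesis by blast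
          qed
        qed
        \<comment> \<open>If the new base point has one of the focused colours, a configuration is
          complete; otherwise \<open>r + 1\<close> colours are focused.\<close>
        show ?thesis
        proof (cases "c a' \<in> C'")
          case True
          then obtain \<beta>' where "\<beta>' \<in> \<Gamma>3" "\<forall>v\<in>V. c (a' + v \<beta>') = c a'"
            using foc' unfolding focused_def by blast
          then show ?thesis using a'D by blast
        next
          case False
          then show ?thesis using a'D C' foc' by blast
        qed
      qed
    qed
    ultimately show ?case by blast
  qed
  from this[of k] obtain D \<Gamma> where *: "finite D" "?nice \<Gamma>"
    "\<And>c :: int \<Rightarrow> nat. \<forall>n. c n < k \<Longrightarrow>
      ?good c D \<Gamma> \<or> (\<exists>a\<in>D. \<exists>C. C \<subseteq> {..<k} \<and> card C = k \<and> c a \<notin> C \<and> focused V c a \<Gamma> C)" by blast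
  have "?good c D \<Gamma>" if c: "\<forall>n. c n < k" for c :: "int \<Rightarrow> nat"
  proof -
    have "C = {..<k}" if "C \<subseteq> {..<k}" "card C = k" for C
      by (rule card_subset_eq) (use that in auto)
    then show ?thesis using *(3)[OF c] c by blast
  qed
  then show "\<exists>D \<Gamma>. finite D \<and> finite \<Gamma> \<and> (\<forall>\<beta>\<in>\<Gamma>. finite \<beta> \<and> \<beta> \<noteq> {} \<and> \<beta> \<subseteq> {M<..}) \<and>
     (\<forall>c :: int \<Rightarrow> nat. (\<forall>n. c n < k) \<longrightarrow> (\<exists>a\<in>D. \<exists>\<beta>\<in>\<Gamma>. \<forall>v\<in>V. c (a + v \<beta>) = c a))"
    using *(1,2) by blast
qed

lemma recurrent_empty: "recurrent {}"
  unfolding recurrent_def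
proof (intro allI)
  fix k M :: nat
  show "\<exists>D \<Gamma>. finite D \<and> finite \<Gamma> \<and> (\<forall>\<beta>\<in>\<Gamma>. finite \<beta> \<and> \<beta> \<noteq> {} \<and> \<beta> \<subseteq> {M<..}) \<and>
     (\<forall>c :: int \<Rightarrow> nat. (\<forall>n. c n < k) \<longrightarrow> (\<exists>a\<in>D. \<exists>\<beta>\<in>\<Gamma>. \<forall>v\<in>{}. c (a + v \<beta>) = c a))"
    by (rule exI[of _ "{0}"], rule exI[of _ "{{Suc M}}"]) auto
qed

text \<open>A function vanishing on finite sets imposes no condition, as
  \<open>a + v \<beta> = a\<close>. The PET step discards such functions, for which a class of index
  below \<open>0\<close> might be required.\<close>

lemma recurrent_nonzero:
  assumes "recurrent {v \<in> V. \<not> vip_deg 0 v}"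
  shows "recurrent V"
  unfolding recurrent_def
proof (intro allI)
  fix k M :: nat
  obtain D \<Gamma> where *: "finite D" "finite \<Gamma>" "\<forall>\<beta>\<in>\<Gamma>. finite \<beta> \<and> \<beta> \<noteq> {} \<and> \<beta> \<subseteq> {M<..}"
     "\<And>c :: int \<Rightarrow> nat. \<forall>n. c n < k \<Longrightarrow>
        \<exists>a\<in>D. \<exists>\<beta>\<in>\<Gamma>. \<forall>v\<in>{v \<in> V. \<not> vip_deg 0 v}. c (a + v \<beta>) = c a"
    by (rule recurrentE[OF assms, of M k]) (rule that; assumption)
  have "\<exists>a\<in>D. \<exists>\<beta>\<in>\<Gamma>. \<forall>v\<in>V. c (a + v \<beta>) = c a" if c: "\<forall>n. c n < k" for c :: "int \<Rightarrow> nat"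
  proof -
    obtain a \<beta> where a: "a \<in> D" "\<beta> \<in> \<Gamma>" "\<forall>v\<in>{v \<in> V. \<not> vip_deg 0 v}. c (a + v \<beta>) = c a"
      using *(4)[OF c] by blast
    have "c (a + v \<beta>) = c a" if "v \<in> V" for v
      using a *(3) that by (cases "vip_deg 0 v") auto
    then show ?thesis using a by blast
  qed
  then show "\<exists>D \<Gamma>. finite D \<and> finite \<Gamma> \<and> (\<forall>\<beta>\<in>\<Gamma>. finite \<beta> \<and> \<beta> \<noteq> {} \<and> \<beta> \<subseteq> {M<..}) \<and>
     (\<forall>c :: int \<Rightarrow> nat. (\<forall>n. c n < k) \<longrightarrow> (\<exists>a\<in>D. \<exists>\<beta>\<in>\<Gamma>. \<forall>v\<in>V. c (a + v \<beta>) = c a))"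
    using * by blast
qed

text \<open>A pair \<open>(i, r)\<close> stands for the class of \<open>r\<close>, of degree at most \<open>i + 1\<close>, modulo degree \<open>i\<close>. The
  multiset of the first components is the PET weight: subtracting a function from the class of
  least index removes that class at the cost of classes of smaller index.\<close>

definition covered :: "(nat \<times> (nat set \<Rightarrow> int)) multiset \<Rightarrow> (nat set \<Rightarrow> int) set \<Rightarrow> bool" where
  "covered R V \<longleftrightarrow> (\<forall>(i, r) \<in># R. vip_deg (Suc i) r) \<and>
     (\<forall>v\<in>V. \<exists>(i, r) \<in># R. vip_deg i (\<lambda>\<beta>. v \<beta> - r \<beta>))"

lemma recurrent_covered:
  assumes "finite V" "covered R V"
  shows "recurrent V"
  using assms
proof (induction "image_mset fst R" arbitrary: R V rule: wf_induct_rule[OF wf_mult[OF wf_less_than]])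
  case (1 R V)
  have Rdeg: "\<And>i r. (i, r) \<in># R \<Longrightarrow> vip_deg (Suc i) r"
    and Vcov: "\<And>v. v \<in> V \<Longrightarrow> \<exists>i r. (i, r) \<in># R \<and> vip_deg i (\<lambda>\<beta>. v \<beta> - r \<beta>)"
    using 1(3) unfolding covered_def by fast+
  show ?case
  proof (cases "V = {}")
    case True
    then show ?thesis using recurrent_empty by simp
  next
    case False
    then have "set_mset R \<noteq> {}" using Vcov by fastforce
    \<comment> \<open>The index is least so that classes of larger index \<open>i\<close> survive
      the subtraction of \<open>u\<close>, whose degree is at most
      \<open>i1 + 1 \<le> i\<close>.\<close>
    then obtain i1 r1 where R1: "(i1, r1) \<in># R" and min: "\<And>i r. (i, r) \<in># R \<Longrightarrow> i1 \<le> i"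
      using arg_min_if_finite[of "set_mset R" fst] by (metis finite_set_mset fst_conv linorder_not_le prod.collapse)
    define R0 where "R0 = R - {#(i1, r1)#}"
    have R: "R = add_mset (i1, r1) R0" using R1 by (simp add: R0_def)
    show ?thesis
    proof (cases "\<exists>u\<in>V. vip_deg i1 (\<lambda>\<beta>. u \<beta> - r1 \<beta>)")
      case False
      \<comment> \<open>No function of \<open>V\<close> lies in the class of \<open>r1\<close>, so
        this class is dropped and the weight decreases.\<close>
      have "\<exists>(i, r) \<in># R0. vip_deg i (\<lambda>\<beta>. v \<beta> - r \<beta>)" if "v \<in> V" for v
        using Vcov[OF that] False that unfolding R by auto
      then have "covered R0 V" unfolding covered_def using Rdeg R by auto
      moreover have "(image_mset fst R0, image_mset fst R) \<in> mult less_than"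
        by (rule subset_implies_mult) (simp add: R)
      ultimately show ?thesis using 1 by blast
    next
      case True
      then obtain u where u: "u \<in> V" "vip_deg i1 (\<lambda>\<beta>. u \<beta> - r1 \<beta>)" by blast
      have Vdeg: "vip_deg (Suc i) v" if "(i, r) \<in># R" "vip_deg i (\<lambda>\<beta>. v \<beta> - r \<beta>)" for v i r
        using vip_deg_add[OF vip_deg_Suc[OF that(2)] Rdeg[OF that(1)]] by simp
      show ?thesis
      proof (rule recurrent_step[OF 1(2) u(1)])
        fix v assume "v \<in> V"
        then show "v {} = 0" using Vcov Vdeg vip_deg_empty by blast
      next
        fix \<Gamma> :: "nat set set" assume \<Gamma>: "finite \<Gamma>" "\<And>\<gamma>. \<gamma> \<in> \<Gamma> \<Longrightarrow> finite \<gamma>"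
        define b where "b = (\<lambda>(v :: nat set \<Rightarrow> int, \<gamma>) \<beta>. v \<beta> - u \<beta> + set_deriv \<gamma> v \<beta>)"
        define B where "B = {w \<in> b ` (V \<times> \<Gamma>). \<not> vip_deg 0 w}"
        have finB: "finite B" using \<Gamma>(1) 1(2) by (simp add: B_def)
        \<comment> \<open>As \<open>u\<close> lies in the class of \<open>r1\<close>, subtracting it
          moves a class \<open>r\<close> of the same index to \<open>r - r1\<close>. For larger
          indices \<open>u\<close> is negligible and the class stays.\<close>
        define sh where "sh = (\<lambda>(i :: nat, r :: nat set \<Rightarrow> int). if i = i1 then (i, \<lambda>\<beta>. r \<beta> - r1 \<beta>) else (i, r))"
        \<comment> \<open>Functions coming from the class of \<open>r1\<close> itself now have
          degree at most \<open>i1\<close>, and each gets a class of its own of index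
          \<open>i1 - 1\<close>. For \<open>i1 = 0\<close> they vanish and are absent from
          \<open>B\<close>.\<close>
        define K where "K = image_mset (\<lambda>w. (i1 - 1, w)) (mset_set {w \<in> B. i1 \<noteq> 0 \<and> vip_deg i1 w})"
        define R' where "R' = image_mset sh R0 + K"
        have fsh: "fst \<circ> sh = fst" by (auto simp: sh_def fun_eq_iff)
        have less: "(image_mset fst R', image_mset fst R) \<in> mult less_than"
        proof -
          have "\<forall>x \<in># image_mset fst K. \<exists>y \<in># {#i1#}. (x, y) \<in> less_than"
            using finB by (auto simp: K_def)
          then have "(image_mset fst R0 + image_mset fst K, image_mset fst R0 + {#i1#}) \<in> mult less_than"
            by (intro one_step_implies_mult) simp_all
          then show ?thesis by (simp add: R'_def R multiset.map_comp fsh)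
        qed
        have "covered R' B"
          unfolding covered_def
        proof (intro conjI ballI)
          fix x assume "x \<in># R'"
          then consider i r where "(i, r) \<in># R0" "x = sh (i, r)" | w where "i1 \<noteq> 0" "vip_deg i1 w" "x = (i1 - 1, w)"
            using finB by (fastforce simp: R'_def K_def)
          then show "case x of (i, r) \<Rightarrow> vip_deg (Suc i) r"
          proof cases
            case 1
            then have "(i, r) \<in># R" by (simp add: R)
            show ?thesis
            proof (cases "i = i1")
              case True
              then show ?thesis using 1 vip_deg_diff[OF Rdeg[OF \<open>(i, r) \<in># R\<close>]] Rdeg[OF R1]
                by (simp add: sh_def del: vip_deg.simps)
            next
              case False
              then show ?thesis using 1 Rdeg[OF \<open>(i, r) \<in># R\<close>] by (simp add: sh_def)
            qed
          next
            case 2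
            then show ?thesis by (cases i1) auto
          qed
        next
          fix w assume w: "w \<in> B"
          then obtain v \<gamma> where v: "v \<in> V" and \<gamma>: "\<gamma> \<in> \<Gamma>" and wv: "w = b (v, \<gamma>)"
            and nz: "\<not> vip_deg 0 w" by (auto simp: B_def)
          obtain i r where ir: "(i, r) \<in># R" "vip_deg i (\<lambda>\<beta>. v \<beta> - r \<beta>)" using Vcov[OF v] by blast
          \<comment> \<open>The derivative has degree at most \<open>i\<close>, so adding it does
            not change a class modulo degree \<open>i\<close>.\<close>
          have dv: "vip_deg i (set_deriv \<gamma> v)" using Vdeg[OF ir] \<Gamma>(2)[OF \<gamma>] by simp
          show "\<exists>(i, r) \<in># R'. vip_deg i (\<lambda>\<beta>. w \<beta> - r \<beta>)"
          proof (cases "i = i1")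
            case False
            then have "Suc i1 \<le> i" using min[OF ir(1)] by simp
            then have "vip_deg i u" using vip_deg_mono[OF Vdeg[OF R1 u(2)]] by blast
            from vip_deg_add[OF vip_deg_diff[OF ir(2) this] dv]
            have "vip_deg i (\<lambda>\<beta>. w \<beta> - r \<beta>)"
              unfolding wv b_def by (simp add: algebra_simps)
            moreover have "(i, r) \<in># R'"
            proof -
              have "(i, r) \<in># R0" using ir(1) False by (auto simp: R)
              moreover have "sh (i, r) = (i, r)" using False by (simp add: sh_def)
              ultimately show ?thesis unfolding R'_def by force
            qed
            ultimately show ?thesis by blast
          next
            case True
            have eq: "vip_deg i (\<lambda>\<beta>. w \<beta> - (r \<beta> - r1 \<beta>))"
              using vip_deg_add[OF vip_deg_diff[OF ir(2) u(2)[folded True]] dv]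
              unfolding wv b_def by (simp add: algebra_simps)
            show ?thesis
            proof (cases "(i, r) \<in># R0")
              case in0: True
              have "sh (i, r) \<in># R'" using in0 unfolding R'_def by simp
              moreover have "sh (i, r) = (i, \<lambda>\<beta>. r \<beta> - r1 \<beta>)" using True by (simp add: sh_def)
              ultimately have "(i, \<lambda>\<beta>. r \<beta> - r1 \<beta>) \<in># R'" by simp
              with eq show ?thesis by (intro bexI[of _ "(i, \<lambda>\<beta>. r \<beta> - r1 \<beta>)"]) simp_all
            next
              case False
              then have "r = r1" using ir(1) by (auto simp: R)
              with eq have wi: "vip_deg i1 w" using True by simp
              with nz have "i1 \<noteq> 0" by (metis)
              then have "(i1 - 1, w) \<in># R'" using w wi finB by (simp add: R'_def K_def)
              moreover have "vip_deg (i1 - 1) (\<lambda>\<beta>. w \<beta> - w \<beta>)"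
                by (rule vip_deg_mono[of 0]) auto
              ultimately show ?thesis by blast
            qed
          qed
        qed
        with finB have "recurrent B" using 1(1)[OF less] \<open>covered R' B\<close> by blast
        then show "recurrent ((\<lambda>(v, \<gamma>) \<beta>. v \<beta> - u \<beta> + set_deriv \<gamma> v \<beta>) ` (V \<times> \<Gamma>))"
          using recurrent_nonzero[of "b ` (V \<times> \<Gamma>)"] unfolding B_def b_def by blast
      qed
    qed
  qed
qed

section \<open>Recurrence for polynomials of finite sums\<close>

lemma recurrent_vip:
  assumes "finite V" "\<And>v. v \<in> V \<Longrightarrow> \<exists>d. vip_deg d v"
  shows "recurrent V"
proof -
  obtain d where d: "\<And>v. v \<in> V \<Longrightarrow> vip_deg (d v) v" using assms(2) by metis
  let ?R = "image_mset (\<lambda>v. (d v, v)) (mset_set V)"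
  have "vip_deg (d v) (\<lambda>\<beta>. v \<beta> - v \<beta>)" for v by (rule vip_deg_mono[of 0]) auto
  then have "\<exists>(i, r) \<in># ?R. vip_deg i (\<lambda>\<beta>. v \<beta> - r \<beta>)" if "v \<in> V" for v
    using assms(1) that by (intro bexI[of _ "(d v, v)"]) auto
  moreover have "\<forall>(i, r) \<in># ?R. vip_deg (Suc i) r"
    using assms(1) vip_deg_Suc[OF d] by auto
  ultimately have "covered ?R V" unfolding covered_def by blast
  then show ?thesis using assms(1) recurrent_covered by blast
qed

text \<open>\<open>P(X + s)\<close> and \<open>P(X)\<close> have the same degree and the same
  leading coefficient, so the top terms cancel.\<close>

lemma degree_poly_shift_less:
  fixes P :: "int poly"
  assumes "degree P \<le> Suc d"
  shows "degree (pcompose P [:s, 1:] - P) \<le> d"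
proof (rule degree_le, intro allI impI)
  fix i assume "d < i"
  have deg: "degree (pcompose P [:s, 1:]) = degree P" by (simp add: degree_pcompose)
  show "coeff (pcompose P [:s, 1:] - P) i = 0"
  proof (cases "i = degree P")
    case True
    then show ?thesis using lead_coeff_comp[of "[:s, 1:]" P] deg by simp
  next
    case False
    then show ?thesis using \<open>d < i\<close> assms by (simp add: coeff_eq_0 deg)
  qed
qed

text \<open>The derivative along \<open>\<gamma>\<close> is again a polynomial of finite sums, of
  lower degree, which allows induction on the degree.\<close>

lemma vip_deg_poly:
  fixes P :: "int poly" and f :: "nat \<Rightarrow> int"
  assumes "degree P \<le> d" "coeff P 0 = 0"
  shows "vip_deg d (\<lambda>\<beta>. poly P (\<Sum>t\<in>\<beta>. f t))"
  using assms
proof (induction d arbitrary: P f)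
  case 0
  then have "P = 0" by (metis degree_0_id le_zero_eq leading_coeff_0_iff pCons_0_0)
  then show ?case by simp
next
  case (Suc d)
  show ?case unfolding vip_deg.simps
  proof (intro allI impI)
    fix \<gamma> :: "nat set" assume \<gamma>: "finite \<gamma>"
    define s where "s = sum f \<gamma>"
    \<comment> \<open>Setting \<open>f\<close> to \<open>0\<close> on \<open>\<gamma>\<close> makes
      the sum over \<open>\<beta>\<close> equal to the sum over \<open>\<beta> - \<gamma>\<close>,
      the set that \<open>set_deriv\<close> refers to.\<close>
    define f' where "f' t = (if t \<in> \<gamma> then 0 else f t)" for t
    \<comment> \<open>\<open>Q(x) = P(s + x) - P(x) - P(s)\<close>, whose value at \<open>0\<close>
      is \<open>- P(0) = 0\<close>.\<close>
    define Q where "Q = pcompose P [:s, 1:] - P - [:poly P s:]"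
    have "degree Q \<le> d"
      unfolding Q_def by (intro degree_diff_le degree_poly_shift_less Suc.prems) simp
    moreover have "coeff Q 0 = 0"
      using Suc.prems(2) by (simp add: Q_def poly_pcompose flip: poly_0_coeff_0)
    ultimately have "vip_deg d (\<lambda>\<beta>. poly Q (\<Sum>t\<in>\<beta>. f' t))" by (rule Suc.IH)
    moreover have "poly Q (\<Sum>t\<in>\<beta>. f' t) = set_deriv \<gamma> (\<lambda>\<beta>. poly P (\<Sum>t\<in>\<beta>. f t)) \<beta>"
      if "finite \<beta>" for \<beta>
    proof -
      have "(\<Sum>t\<in>\<beta>. f' t) = (\<Sum>t\<in>\<beta> - \<gamma>. f t)"
        using that by (intro sum.mono_neutral_cong_right) (auto simp: f'_def)
      moreover have "sum f (\<gamma> \<union> \<beta>) = s + sum f (\<beta> - \<gamma>)"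
        using that \<gamma> sum.union_disjoint[of \<gamma> "\<beta> - \<gamma>" f] by (simp add: s_def Un_Diff_cancel)
      ultimately show ?thesis by (simp add: Q_def set_deriv_def poly_pcompose s_def)
    qed
    ultimately show "vip_deg d (set_deriv \<gamma> (\<lambda>\<beta>. poly P (\<Sum>t\<in>\<beta>. f t)))"
      by (subst (asm) vip_deg_cong)
  qed
qed

section \<open>The ideal \<open>Jp\<close>\<close>

text \<open>The cover is turned into a colouring of the integers, to which recurrence of the
  finitely many functions \<open>\<beta> \<mapsto> P(\<Sum>t\<in>\<beta>. f t)\<close> and their
  negatives applies.\<close>

lemma polynomial_van_der_Waerden:
  fixes F :: "int poly set" and H :: "(nat \<Rightarrow> nat) set"
  assumes F: "finite F" "F \<subseteq> Polys0" and H: "finite H"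
    and B: "finite \<B>" "Npos \<subseteq> \<Union>\<B>"
  shows "\<exists>B\<in>\<B>. \<exists>a\<in>Npos. \<exists>\<beta>\<in>Pf Npos. \<forall>P\<in>F. \<forall>f\<in>H.
    int a + poly P (int (\<Sum>t\<in>\<beta>. f t)) \<in> int ` B"
proof -
  obtain h where h: "bij_betw h \<B> {0..<card \<B>}"
    using ex_bij_betw_finite_nat[OF B(1)] by blast
  have "\<exists>g. \<forall>n\<in>Npos. g n \<in> \<B> \<and> n \<in> g n" using B(2) by (intro bchoice) blast
  then obtain g where g: "\<And>n. n \<in> Npos \<Longrightarrow> g n \<in> \<B>" "\<And>n. n \<in> Npos \<Longrightarrow> n \<in> g n" by blast
  define c where "c n = h (g n)" for n
  have c: "c n < card \<B>" if "n \<in> Npos" for n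
    using bij_betwE[OF h] g(1)[OF that] by (auto simp: c_def)
  have same: "n \<in> g n'" if "c n = c n'" "n \<in> Npos" "n' \<in> Npos" for n n'
  proof -
    have "g n = g n'" using inj_onD[OF bij_betw_imp_inj_on[OF h]] that g(1) unfolding c_def by blast
    then show ?thesis using g(2)[OF that(2)] by simp
  qed
  define F' where "F' = F \<union> uminus ` F"
  define val where "val = (\<lambda>(P, f :: nat \<Rightarrow> nat) \<beta>. poly P (\<Sum>t\<in>\<beta>. int (f t)))"
  have F': "coeff P 0 = 0" if "P \<in> F'" for P
    using that F(2) by (auto simp: F'_def Polys0_def)
  have "recurrent (val ` (F' \<times> H))"
  proof (rule recurrent_vip)
    show "finite (val ` (F' \<times> H))" using F(1) H by (simp add: F'_def)
    show "\<exists>d. vip_deg d v" if v: "v \<in> val ` (F' \<times> H)" for v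
    proof -
      obtain P f where "P \<in> F'" "v = val (P, f)" using v by blast
      then show ?thesis using vip_deg_poly[OF le_refl F'] unfolding val_def by auto
    qed
  qed
  \<comment> \<open>The bound \<open>0\<close> keeps \<open>\<beta>\<close> inside
    \<open>Npos\<close>. The number of colours is doubled because parity will separate the positive
    integers from the others.\<close>
  then obtain D \<Gamma> where \<Gamma>: "\<forall>\<beta>\<in>\<Gamma>. finite \<beta> \<and> \<beta> \<noteq> {} \<and> \<beta> \<subseteq> {0<..}"
    and DG: "\<And>\<chi> :: int \<Rightarrow> nat. \<forall>n. \<chi> n < 2 * card \<B> \<Longrightarrow>
        \<exists>a\<in>D. \<exists>\<beta>\<in>\<Gamma>. \<forall>v\<in>val ` (F' \<times> H). \<chi> (a + v \<beta>) = \<chi> a"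
    by (rule recurrentE[of _ 0 "2 * card \<B>"]) (rule that; assumption)
  \<comment> \<open>The negative half line carries the reflected colouring; as \<open>F'\<close> is closed under negation,
    a configuration found there reflects to one among the positive integers.\<close>
  define \<chi> where "\<chi> n = (if n \<ge> 1 then 2 * c (nat n) + 1 else 2 * c (nat (1 - n)))" for n :: int
  have "\<forall>n. \<chi> n < 2 * card \<B>"
  proof
    fix n
    show "\<chi> n < 2 * card \<B>"
    proof (cases "n \<ge> 1")
      case True
      then have "c (nat n) < card \<B>" by (intro c) (simp add: le_nat_iff)
      then show ?thesis using True by (simp add: \<chi>_def)
    next
      case False
      then have "c (nat (1 - n)) < card \<B>" by (intro c) (simp add: le_nat_iff)
      then show ?thesis using False by (simp add: \<chi>_def)
    qed
  qed
  from DG[OF this] obtain a \<beta> where \<beta>: "\<beta> \<in> \<Gamma>"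
    and mono: "\<forall>v\<in>val ` (F' \<times> H). \<chi> (a + v \<beta>) = \<chi> a" by blast
  have "{0 :: nat<..} = Npos" by auto
  then have \<beta>P: "\<beta> \<in> Pf Npos" using bspec[OF \<Gamma> \<beta>] by (simp add: Pf_def)
  define s where "s f = int (\<Sum>t\<in>\<beta>. f t)" for f :: "nat \<Rightarrow> nat"
  have \<chi>: "\<chi> (a + poly P (s f)) = \<chi> a" "\<chi> (a - poly P (s f)) = \<chi> a" if "P \<in> F" "f \<in> H" for P f
  proof -
    have "val (P, f) \<in> val ` (F' \<times> H)" "val (- P, f) \<in> val ` (F' \<times> H)"
      using that by (auto simp: F'_def)
    from this[THEN mono[rule_format]]
    show "\<chi> (a + poly P (s f)) = \<chi> a" "\<chi> (a - poly P (s f)) = \<chi> a"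
      by (simp_all add: val_def s_def)
  qed
  define a' where "a' = (if a \<ge> 1 then nat a else nat (1 - a))"
  have a': "a' \<in> Npos" by (auto simp: a'_def)
  have config: "int a' + poly P (s f) \<in> int ` g a'" if "P \<in> F" "f \<in> H" for P f
  proof -
    have pos: "1 \<le> int a' + poly P (s f) \<and> c (nat (int a' + poly P (s f))) = c a'"
    proof (cases "a \<ge> 1")
      case True
      then have "\<chi> (a + poly P (s f)) = 2 * c a' + 1"
        using \<chi>(1)[OF that] by (simp add: \<chi>_def a'_def)
      moreover have "\<chi> n \<noteq> 2 * c a' + 1" if "\<not> 1 \<le> n" for n
        using that by (simp add: \<chi>_def double_not_eq_Suc_double Suc_double_not_eq_double)
      ultimately have "1 \<le> a + poly P (s f)" by blast
      then show ?thesis using \<open>\<chi> _ = 2 * c a' + 1\<close> True by (simp add: \<chi>_def a'_def)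
    next
      case False
      then have *: "\<chi> (a - poly P (s f)) = 2 * c a'"
        using \<chi>(2)[OF that] by (simp add: \<chi>_def a'_def)
      moreover have "\<chi> n \<noteq> 2 * c a'" if "1 \<le> n" for n
        using that by (simp add: \<chi>_def double_not_eq_Suc_double Suc_double_not_eq_double)
      ultimately have "\<not> 1 \<le> a - poly P (s f)" by blast
      \<comment> \<open>The reflection \<open>n \<mapsto> 1 - n\<close> turns
        \<open>a - P(s)\<close> into \<open>(1 - a) + P(s)\<close>, where
        \<open>1 - a = a'\<close>.\<close>
      then show ?thesis using * False by (simp add: \<chi>_def a'_def algebra_simps)
    qed
    define N where "N = nat (int a' + poly P (s f))"
    have N: "int N = int a' + poly P (s f)" "N \<in> Npos" using pos by (auto simp: N_def)
    have "N \<in> g a'" using pos N(2) by (intro same a') (simp_all add: N_def)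
    then show ?thesis unfolding N(1)[symmetric] by (rule imageI)
  qed
  have "\<forall>P\<in>F. \<forall>f\<in>H. int a' + poly P (int (\<Sum>t\<in>\<beta>. f t)) \<in> int ` g a'"
    unfolding s_def[symmetric] by (intro ballI config)
  then show ?thesis
    using g(1)[OF a'] a' \<beta>P by (intro bexI[of _ "g a'"] bexI[of _ a'] bexI[of _ \<beta>])
qed

text \<open>Each \<open>B\<close> comes with sets \<open>F B\<close> and \<open>H B\<close> that
  refute it. The van der Waerden theorem for the unions of all of these puts a configuration into
  some \<open>B\<close>, against its own witnesses.\<close>

lemma non_Jp_sets_do_not_cover:
  assumes fin: "finite \<B>" and B: "\<And>B. B \<in> \<B> \<Longrightarrow> B \<subseteq> Npos \<and> \<not> Jp_set B"
  shows "\<not> Npos \<subseteq> \<Union>\<B>"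
proof
  assume cov: "Npos \<subseteq> \<Union>\<B>"
  have "\<exists>F H. F \<in> Pf Polys0 \<and> H \<in> Pf NN \<and> \<not> (\<exists>a\<in>Npos. \<exists>\<beta>\<in>Pf Npos. \<forall>P\<in>F. \<forall>f\<in>H.
      int a + poly P (int (\<Sum>t\<in>\<beta>. f t)) \<in> int ` B)" if "B \<in> \<B>" for B
    using B[OF that] unfolding Jp_set_def by blast
  then obtain F H where FH: "\<And>B. B \<in> \<B> \<Longrightarrow> F B \<in> Pf Polys0" "\<And>B. B \<in> \<B> \<Longrightarrow> H B \<in> Pf NN"
    and no: "\<And>B. B \<in> \<B> \<Longrightarrow> \<not> (\<exists>a\<in>Npos. \<exists>\<beta>\<in>Pf Npos. \<forall>P\<in>F B. \<forall>f\<in>H B.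
      int a + poly P (int (\<Sum>t\<in>\<beta>. f t)) \<in> int ` B)"
    by metis
  have 1: "finite (\<Union>B\<in>\<B>. F B)" "(\<Union>B\<in>\<B>. F B) \<subseteq> Polys0" "finite (\<Union>B\<in>\<B>. H B)"
    using fin FH by (auto simp: Pf_def)
  obtain B a \<beta> where "B \<in> \<B>" "a \<in> Npos" "\<beta> \<in> Pf Npos"
    "\<forall>P\<in>(\<Union>B\<in>\<B>. F B). \<forall>f\<in>(\<Union>B\<in>\<B>. H B). int a + poly P (int (\<Sum>t\<in>\<beta>. f t)) \<in> int ` B"
    using polynomial_van_der_Waerden[OF 1 fin cov] by blast
  with no[OF \<open>B \<in> \<B>\<close>] show False by blast
qed

section \<open>Ultrafilters from the finite intersection property\<close>

text \<open>Zorn's lemma gives a maximal family with the finite intersection property, and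
  maximality makes it an ultrafilter.\<close>

lemma ultrafilter_extension:
  assumes \<Phi>: "\<Phi> \<subseteq> Pow X" "\<And>\<Psi>. finite \<Psi> \<Longrightarrow> \<Psi> \<subseteq> \<Phi> \<Longrightarrow> X \<inter> \<Inter>\<Psi> \<noteq> {}"
  obtains p where "ultrafilter_on X p" "\<Phi> \<subseteq> p"
proof -
  define fip where "fip \<Phi>' \<longleftrightarrow> (\<forall>\<Psi>. finite \<Psi> \<and> \<Psi> \<subseteq> \<Phi>' \<longrightarrow> X \<inter> \<Inter>\<Psi> \<noteq> {})" for \<Phi>' :: "'a set set"
  define \<A> where "\<A> = {\<Phi>'. \<Phi> \<subseteq> \<Phi>' \<and> \<Phi>' \<subseteq> Pow X \<and> fip \<Phi>'}"
  have "\<exists>p\<in>\<A>. \<forall>q\<in>\<A>. p \<subseteq> q \<longrightarrow> q = p"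
  proof (rule subset_Zorn_nonempty)
    have "\<Phi> \<in> \<A>" using \<Phi> by (simp add: \<A>_def fip_def)
    then show "\<A> \<noteq> {}" by blast
  next
    fix C assume C: "C \<noteq> {}" "subset.chain \<A> C"
    then have CA: "\<And>c. c \<in> C \<Longrightarrow> c \<in> \<A>" by (auto simp: subset.chain_def)
    have "fip (\<Union>C)" unfolding fip_def
    proof (intro allI impI, elim conjE)
      fix \<Psi> assume "finite \<Psi>" "\<Psi> \<subseteq> \<Union>C"
      then obtain c where "c \<in> C" "\<Psi> \<subseteq> c" using finite_subset_Union_chain[OF _ _ C] by metis
      then show "X \<inter> \<Inter>\<Psi> \<noteq> {}" using CA \<open>finite \<Psi>\<close> by (auto simp: \<A>_def fip_def)
    qed
    moreover have "\<Phi> \<subseteq> \<Union>C"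
    proof -
      obtain c where "c \<in> C" using C(1) by blast
      then show ?thesis using CA[OF \<open>c \<in> C\<close>] by (auto simp: \<A>_def)
    qed
    moreover have "\<Union>C \<subseteq> Pow X" using CA by (auto simp: \<A>_def)
    ultimately show "\<Union>C \<in> \<A>" by (simp add: \<A>_def)
  qed
  then obtain p where pA: "p \<in> \<A>" and max: "\<And>q. q \<in> \<A> \<Longrightarrow> p \<subseteq> q \<Longrightarrow> q = p" by blast
  have p: "\<Phi> \<subseteq> p" "p \<subseteq> Pow X" and fip: "\<And>\<Psi>. finite \<Psi> \<Longrightarrow> \<Psi> \<subseteq> p \<Longrightarrow> X \<inter> \<Inter>\<Psi> \<noteq> {}"
    using pA by (auto simp: \<A>_def fip_def)
  \<comment> \<open>Such a set can be added to \<open>p\<close> without losing the finite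
    intersection property, so it is already there. The membership axioms of an ultrafilter are all
    checked through this criterion.\<close>
  have key: "A \<in> p" if "A \<subseteq> X" and meets: "\<And>\<Psi>. finite \<Psi> \<Longrightarrow> \<Psi> \<subseteq> p \<Longrightarrow> A \<inter> (X \<inter> \<Inter>\<Psi>) \<noteq> {}" for A
  proof -
    have "fip (insert A p)" unfolding fip_def
    proof (intro allI impI, elim conjE)
      fix \<Psi> assume "finite \<Psi>" "\<Psi> \<subseteq> insert A p"
      then have "A \<inter> (X \<inter> \<Inter>(\<Psi> - {A})) \<noteq> {}" by (intro meets) auto
      then show "X \<inter> \<Inter>\<Psi> \<noteq> {}" by blast
    qed
    then have "insert A p \<in> \<A>" using p \<open>A \<subseteq> X\<close> by (auto simp: \<A>_def)
    from max[OF this] show ?thesis by blast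
  qed
  have "ultrafilter_on X p"
    unfolding ultrafilter_on_def
  proof (intro conjI ballI allI impI)
    show "p \<subseteq> Pow X" by fact
    show "X \<in> p" by (rule key) (use fip in auto)
    show "{} \<notin> p" using fip[of "{{}}"] by auto
  next
    fix A B assume AB: "A \<in> p" "B \<in> p"
    show "A \<inter> B \<in> p"
    proof (rule key)
      fix \<Psi> assume "finite \<Psi>" "\<Psi> \<subseteq> p"
      then show "A \<inter> B \<inter> (X \<inter> \<Inter>\<Psi>) \<noteq> {}" using fip[of "{A, B} \<union> \<Psi>"] AB by (auto simp: ac_simps)
    qed (use p AB in auto)
  next
    fix A B assume A: "A \<in> p" "A \<subseteq> B \<and> B \<subseteq> X"
    show "B \<in> p"
    proof (rule key)
      fix \<Psi> assume "finite \<Psi>" "\<Psi> \<subseteq> p"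
      then show "B \<inter> (X \<inter> \<Inter>\<Psi>) \<noteq> {}" using fip[of "insert A \<Psi>"] A by auto
    qed (use A in auto)
  next
    fix A assume "A \<subseteq> X"
    show "A \<in> p \<or> X - A \<in> p"
    proof (rule ccontr)
      assume "\<not> (A \<in> p \<or> X - A \<in> p)"
      then obtain \<Psi>1 \<Psi>2 where "finite \<Psi>1" "\<Psi>1 \<subseteq> p" "A \<inter> (X \<inter> \<Inter>\<Psi>1) = {}"
          "finite \<Psi>2" "\<Psi>2 \<subseteq> p" "(X - A) \<inter> (X \<inter> \<Inter>\<Psi>2) = {}"
        using key[of A] key[of "X - A"] \<open>A \<subseteq> X\<close> by blast
      then show False using fip[of "\<Psi>1 \<union> \<Psi>2"] by blast
    qed
  qed
  then show thesis using that p by blast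
qed

text \<open>The complements of the sets that are not \<open>J\<^sub>p\<close> have the finite
  intersection property, as finitely many such sets do not cover \<open>Npos\<close>. An ultrafilter
  extending them lies in \<open>Jp\<close>.\<close>

lemma Jp_nonempty: "Jp \<noteq> {}"
proof -
  define \<Phi> where "\<Phi> = {Npos - B |B. B \<subseteq> Npos \<and> \<not> Jp_set B}"
  have "Npos \<inter> \<Inter>\<Psi> \<noteq> {}" if \<Psi>: "finite \<Psi>" "\<Psi> \<subseteq> \<Phi>" for \<Psi>
  proof -
    have "\<not> Npos \<subseteq> \<Union>((\<lambda>C. Npos - C) ` \<Psi>)"
    proof (rule non_Jp_sets_do_not_cover)
      fix B assume "B \<in> (\<lambda>C. Npos - C) ` \<Psi>"
      then obtain C where "C \<in> \<Phi>" "B = Npos - C" using \<Psi> by blast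
      then show "B \<subseteq> Npos \<and> \<not> Jp_set B" by (auto simp: \<Phi>_def double_diff)
    qed (use \<Psi> in simp)
    then show ?thesis by blast
  qed
  moreover have "\<Phi> \<subseteq> Pow Npos" by (auto simp: \<Phi>_def)
  ultimately obtain q where q: "ultrafilter_on Npos q" "\<Phi> \<subseteq> q"
    using ultrafilter_extension by metis
  have "Jp_set A" if "A \<in> q" for A
  proof (rule ccontr)
    assume "\<not> Jp_set A"
    moreover have "A \<subseteq> Npos" using q that by (auto simp: ultrafilter_on_def)
    ultimately have "Npos - A \<in> q" using q(2) by (auto simp: \<Phi>_def)
    then have "A \<inter> (Npos - A) \<in> q" using q(1) that unfolding ultrafilter_on_def by blast
    then show False using q(1) by (simp add: ultrafilter_on_def)
  qed
  then have "q \<in> Jp" using q(1) by (simp add: Jp_def betaN_def)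
  then show ?thesis by blast
qed

section \<open>Sums of ultrafilters and the ideal property of \<open>Jp\<close>\<close>

lemma betaN_D:
  assumes "p \<in> betaN"
  shows "\<And>A. A \<in> p \<Longrightarrow> A \<subseteq> Npos" "Npos \<in> p" "{} \<notin> p"
    "\<And>A B. A \<in> p \<Longrightarrow> B \<in> p \<Longrightarrow> A \<inter> B \<in> p"
    "\<And>A B. A \<in> p \<Longrightarrow> A \<subseteq> B \<Longrightarrow> B \<subseteq> Npos \<Longrightarrow> B \<in> p"
    "\<And>A. A \<subseteq> Npos \<Longrightarrow> A \<in> p \<or> Npos - A \<in> p"
proof -
  have u: "p \<subseteq> Pow Npos" "Npos \<in> p" "{} \<notin> p" "\<forall>A\<in>p. \<forall>B\<in>p. A \<inter> B \<in> p"
    "\<forall>A\<in>p. \<forall>B. A \<subseteq> B \<and> B \<subseteq> Npos \<longrightarrow> B \<in> p" "\<forall>A. A \<subseteq> Npos \<longrightarrow> A \<in> p \<or> Npos - A \<in> p"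
    using assms unfolding betaN_def ultrafilter_on_def mem_Collect_eq by simp_all
  show "A \<subseteq> Npos" if "A \<in> p" for A using subsetD[OF u(1) that] by (rule PowD)
  show "Npos \<in> p" "{} \<notin> p" by (fact u)+
  show "A \<inter> B \<in> p" if "A \<in> p" "B \<in> p" for A B using u(4) that by simp
  show "B \<in> p" if "A \<in> p" "A \<subseteq> B" "B \<subseteq> Npos" for A B
    using bspec[OF u(5) that(1)] that(2,3) by simp
  show "A \<in> p \<or> Npos - A \<in> p" if "A \<subseteq> Npos" for A using u(6) that by simp
qed

lemma betaN_Compl: "p \<in> betaN \<Longrightarrow> A \<subseteq> Npos \<Longrightarrow> Npos - A \<in> p \<longleftrightarrow> A \<notin> p"
  using betaN_D(3,4,6) by (metis Diff_disjoint)

lemma betaN_Inter: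
  assumes "p \<in> betaN" "finite S" "\<And>i. i \<in> S \<Longrightarrow> A i \<in> p"
  shows "Npos \<inter> (\<Inter>i\<in>S. A i) \<in> p"
  using assms(2,3)
proof (induction S rule: finite_induct)
  case empty
  then show ?case using betaN_D(2)[OF assms(1)] by simp
next
  case (insert x S)
  then have "A x \<inter> (Npos \<inter> (\<Inter>i\<in>S. A i)) \<in> p" using betaN_D(4)[OF assms(1)] by simp
  then show ?case by (simp add: Int_left_commute)
qed

text \<open>Since \<open>q\<close> is an ultrafilter, \<open>A \<mapsto> D A\<close> commutes with
  intersections and complements; \<open>p \<oplus> q\<close> is the preimage of \<open>p\<close>
  under this map.\<close>

lemma usum_betaN:
  assumes p: "p \<in> betaN" and q: "q \<in> betaN"
  shows "p \<oplus> q \<in> betaN"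
proof -
  define S where "S x A = {y \<in> Npos. x + y \<in> A}" for x :: nat and A
  define D where "D A = {x \<in> Npos. S x A \<in> q}" for A
  have S: "S x (A \<inter> B) = S x A \<inter> S x B" "A \<subseteq> B \<Longrightarrow> S x A \<subseteq> S x B" "S x A \<subseteq> Npos" "S x {} = {}"
    "S x (Npos - A) = Npos - S x A" "S x Npos = Npos" for x A B
    by (auto simp: S_def)
  have DInt: "D A \<inter> D B = D (A \<inter> B)" for A B
  proof -
    have "S x A \<inter> S x B \<in> q \<longleftrightarrow> S x A \<in> q \<and> S x B \<in> q" for x
    proof
      assume h: "S x A \<inter> S x B \<in> q"
      show "S x A \<in> q \<and> S x B \<in> q"
        using betaN_D(5)[OF q h Int_lower1 S(3)] betaN_D(5)[OF q h Int_lower2 S(3)] by (rule conjI)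
    qed (use betaN_D(4)[OF q] in blast)
    then show ?thesis by (auto simp: D_def S(1))
  qed
  have Dmono: "D A \<subseteq> D B" if "A \<subseteq> B" for A B
    using betaN_D(5)[OF q _ S(2)[OF that] S(3)] unfolding D_def by blast
  have Dc: "D (Npos - A) = Npos - D A" for A
    using betaN_Compl[OF q S(3)] unfolding D_def S(5) by blast
  have De: "D {} = {}" "D Npos = Npos"
    using betaN_D(2,3)[OF q] unfolding D_def S(4,6) by auto
  have eq: "p \<oplus> q = {A. A \<subseteq> Npos \<and> D A \<in> p}"
    by (simp add: usum_def D_def S_def)
  have DN: "D A \<subseteq> Npos" for A by (auto simp: D_def)
  have "D A \<in> p \<or> D (Npos - A) \<in> p" for A
    using betaN_D(6)[OF p DN] unfolding Dc .
  moreover have "D (A \<inter> B) \<in> p" if "D A \<in> p" "D B \<in> p" for A B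
    using betaN_D(4)[OF p that] unfolding DInt .
  moreover have "D B \<in> p" if "D A \<in> p" "A \<subseteq> B" for A B
    using betaN_D(5)[OF p that(1) Dmono[OF that(2)] DN] .
  moreover have "D Npos \<in> p" "D {} \<notin> p"
    using betaN_D(2,3)[OF p] unfolding De by blast+
  ultimately show ?thesis
    unfolding betaN_def ultrafilter_on_def eq by blast
qed

lemma two_sided_ideal_Jp: "two_sided_ideal Jp"
proof -
  have "q \<oplus> r \<in> Jp" if q: "q \<in> Jp" and r: "r \<in> betaN" for q r
  proof -
    have qb: "q \<in> betaN" using q by (simp add: Jp_def)
    have "Jp_set A" if A: "A \<in> q \<oplus> r" for A
      unfolding Jp_set_def
    proof (intro conjI ballI)
      show "A \<subseteq> Npos" using A by (simp add: usum_def)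
      fix F H assume FH: "F \<in> Pf Polys0" "H \<in> Pf NN"
      define S where "S x = {y \<in> Npos. x + y \<in> A}" for x
      have "{x \<in> Npos. S x \<in> r} \<in> q" using A by (simp add: usum_def S_def)
      then have "Jp_set {x \<in> Npos. S x \<in> r}" using q by (simp add: Jp_def)
      then obtain a \<beta> where a: "a \<in> Npos" "\<beta> \<in> Pf Npos"
        and in_S: "\<And>P f. P \<in> F \<Longrightarrow> f \<in> H \<Longrightarrow> int a + poly P (int (\<Sum>t\<in>\<beta>. f t)) \<in> int ` {x \<in> Npos. S x \<in> r}"
        using FH unfolding Jp_set_def by meson
      define n where "n = (\<lambda>(P, f). nat (int a + poly P (int (\<Sum>t\<in>\<beta>. f t))))"
      have n: "int (n (P, f)) = int a + poly P (int (\<Sum>t\<in>\<beta>. f t))" "S (n (P, f)) \<in> r"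
        if "P \<in> F" "f \<in> H" for P f
        using in_S[OF that] by (auto simp: n_def)
      have "finite (F \<times> H)" using FH by (simp add: Pf_def)
      \<comment> \<open>Only finitely many translates are involved, so one \<open>y\<close> lies in
        all of them, and \<open>a + y\<close> serves for \<open>A\<close>.\<close>
      then have "Npos \<inter> (\<Inter>i\<in>F \<times> H. S (n i)) \<in> r"
        by (rule betaN_Inter[OF r]) (use n in auto)
      then have "Npos \<inter> (\<Inter>i\<in>F \<times> H. S (n i)) \<noteq> {}" using betaN_D(3)[OF r] by metis
      then obtain y where "y \<in> Npos \<inter> (\<Inter>i\<in>F \<times> H. S (n i))" by blast
      then have y: "y \<in> Npos" "\<And>P f. P \<in> F \<Longrightarrow> f \<in> H \<Longrightarrow> y \<in> S (n (P, f))" by auto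
      have "int (a + y) + poly P (int (\<Sum>t\<in>\<beta>. f t)) \<in> int ` A" if "P \<in> F" "f \<in> H" for P f
      proof -
        have "int (a + y) + poly P (int (\<Sum>t\<in>\<beta>. f t)) = int (n (P, f) + y)"
          using n(1)[OF that] by simp
        moreover have "n (P, f) + y \<in> A" using y(2)[OF that] by (simp add: S_def)
        ultimately show ?thesis by (metis image_eqI)
      qed
      moreover have "a + y \<in> Npos" using a by simp
      ultimately show "\<exists>a\<in>Npos. \<exists>\<beta>\<in>Pf Npos. \<forall>P\<in>F. \<forall>f\<in>H.
          int a + poly P (int (\<Sum>t\<in>\<beta>. f t)) \<in> int ` A" using a(2) by blast
    qed
    then show ?thesis using usum_betaN[OF qb r] by (simp add: Jp_def)
  qed
  moreover have "r \<oplus> q \<in> Jp" if q: "q \<in> Jp" and r: "r \<in> betaN" for q r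
  proof -
    have qb: "q \<in> betaN" using q by (simp add: Jp_def)
    have "Jp_set A" if A: "A \<in> r \<oplus> q" for A
      unfolding Jp_set_def
    proof (intro conjI ballI)
      show "A \<subseteq> Npos" using A by (simp add: usum_def)
      fix F H assume FH: "F \<in> Pf Polys0" "H \<in> Pf NN"
      have "{x \<in> Npos. {y \<in> Npos. x + y \<in> A} \<in> q} \<in> r" using A by (simp add: usum_def)
      then have "{x \<in> Npos. {y \<in> Npos. x + y \<in> A} \<in> q} \<noteq> {}"
        using betaN_D(3)[OF r] by metis
      \<comment> \<open>A single \<open>x\<close> suffices: its translate of \<open>A\<close>
        belongs to \<open>q\<close>, and adding \<open>x\<close> carries a configuration found there
        into \<open>A\<close>.\<close>
      then obtain x where "{y \<in> Npos. x + y \<in> A} \<in> q" by blast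
      then have "Jp_set {y \<in> Npos. x + y \<in> A}" using q by (simp add: Jp_def)
      then obtain a \<beta> where a: "a \<in> Npos" "\<beta> \<in> Pf Npos"
        and in_S: "\<And>P f. P \<in> F \<Longrightarrow> f \<in> H \<Longrightarrow> int a + poly P (int (\<Sum>t\<in>\<beta>. f t)) \<in> int ` {y \<in> Npos. x + y \<in> A}"
        using FH unfolding Jp_set_def by meson
      have "int (x + a) + poly P (int (\<Sum>t\<in>\<beta>. f t)) \<in> int ` A" if Pf: "P \<in> F" "f \<in> H" for P f
      proof -
        obtain y where "int a + poly P (int (\<Sum>t\<in>\<beta>. f t)) = int y" "x + y \<in> A"
          using in_S[OF Pf] by blast
        then show ?thesis by (intro image_eqI[of _ _ "x + y"]) auto
      qed
      moreover have "x + a \<in> Npos" using a by simp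
      ultimately show "\<exists>a\<in>Npos. \<exists>\<beta>\<in>Pf Npos. \<forall>P\<in>F. \<forall>f\<in>H.
          int a + poly P (int (\<Sum>t\<in>\<beta>. f t)) \<in> int ` A" using a(2) by blast
    qed
    then show ?thesis using usum_betaN[OF r qb] by (simp add: Jp_def)
  qed
  moreover have "Jp \<subseteq> betaN" unfolding Jp_def by (rule Collect_restrict)
  ultimately show ?thesis
    using Jp_nonempty unfolding two_sided_ideal_def by blast
qed

lemma minimal_idempotent_Jp: "minimal_idempotent p \<Longrightarrow> p \<in> Jp"
  using two_sided_ideal_Jp by (auto simp: minimal_idempotent_def K_betaN_def)

section \<open>Extending partial sums\<close>

text \<open>This is \<open>B\<^sup>*\<close>, the set of points of \<open>B\<close> that stay in
  \<open>B\<close> after adding \<open>q\<close>-almost every \<open>y\<close>.\<close>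

definition star :: "nat set set \<Rightarrow> nat set \<Rightarrow> nat set" where
  "star q B = {x \<in> B. {y \<in> Npos. x + y \<in> B} \<in> q}"

lemma star_mem:
  assumes q: "q \<in> betaN" "q \<oplus> q = q" and B: "B \<in> q"
  shows "star q B \<in> q"
proof -
  have "B \<in> q \<oplus> q" using q(2) B by simp
  then have "{x \<in> Npos. {y \<in> Npos. x + y \<in> B} \<in> q} \<in> q" by (simp add: usum_def)
  then have "B \<inter> {x \<in> Npos. {y \<in> Npos. x + y \<in> B} \<in> q} \<in> q" by (rule betaN_D(4)[OF q(1) B])
  moreover have "B \<inter> {x \<in> Npos. {y \<in> Npos. x + y \<in> B} \<in> q} = star q B"
    using betaN_D(1)[OF q(1) B] unfolding star_def by blast
  ultimately show ?thesis by simp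
qed

text \<open>With \<open>C = -x + B\<close>, which belongs to \<open>q\<close>, idempotence gives
  \<open>C\<^sup>* \<in> q\<close>, and \<open>C\<^sup>*\<close> is contained in
  \<open>-x + B\<^sup>*\<close>. Hence an extension of a sum can itself be extended.\<close>

lemma star_shift:
  assumes q: "q \<in> betaN" "q \<oplus> q = q" and x: "x \<in> star q B"
  shows "{y \<in> Npos. x + y \<in> star q B} \<in> q"
proof -
  define C where "C = {y \<in> Npos. x + y \<in> B}"
  have "C \<in> q" using x by (simp add: star_def C_def)
  then have "star q C \<in> q" by (rule star_mem[OF q])
  moreover have "star q C \<subseteq> {y \<in> Npos. x + y \<in> star q B}"
    unfolding star_def C_def by (auto simp: ac_simps)
  ultimately show ?thesis using betaN_D(5)[OF q(1)] by (metis (no_types, lifting) mem_Collect_eq subsetI)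
qed

text \<open>The \<open>J\<^sub>p\<close> property is applied to the shifted functions
  \<open>t \<mapsto> f (t + N)\<close>, and the resulting set is moved by \<open>N\<close>. This is
  how the sets \<open>H\<close> become increasing.\<close>

lemma Jp_set_beyond:
  assumes A: "Jp_set A" and F: "F \<in> Pf Polys0" and H: "H \<in> Pf NN"
  obtains a \<beta> where "a \<in> Npos" "\<beta> \<in> Pf Npos" "\<beta> \<subseteq> {N<..}"
    "\<And>P f. P \<in> F \<Longrightarrow> f \<in> H \<Longrightarrow> int a + poly P (int (\<Sum>t\<in>\<beta>. f t)) \<in> int ` A"
proof -
  define sh where "sh f = (\<lambda>t\<in>Npos. f (t + N))" for f :: "nat \<Rightarrow> nat"
  have "sh f \<in> NN" if "f \<in> H" for f
  proof -
    have "f \<in> NN" using that H by (auto simp: Pf_def)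
    then have "f (t + N) \<in> Npos" if "t \<in> Npos" for t
      using that by (intro PiE_mem[of f Npos "\<lambda>_. Npos"]) auto
    then show ?thesis unfolding sh_def by (intro restrict_PiE_iff[THEN iffD2] ballI)
  qed
  then have "sh ` H \<in> Pf NN" using H by (auto simp: Pf_def)
  then obtain a \<beta> where a: "a \<in> Npos" and \<beta>: "\<beta> \<in> Pf Npos"
    and mem: "\<forall>P\<in>F. \<forall>f\<in>sh ` H. int a + poly P (int (\<Sum>t\<in>\<beta>. f t)) \<in> int ` A"
    using A F unfolding Jp_set_def by blast
  have \<beta>N: "\<beta> \<subseteq> Npos" "finite \<beta>" "\<beta> \<noteq> {}" using \<beta> by (auto simp: Pf_def)
  have sum: "(\<Sum>t\<in>\<beta>. sh f t) = (\<Sum>t\<in>(\<lambda>t. t + N) ` \<beta>. f t)" for f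
  proof -
    have "(\<Sum>t\<in>(\<lambda>t. t + N) ` \<beta>. f t) = (\<Sum>t\<in>\<beta>. f (t + N))"
      by (subst sum.reindex) (auto simp: inj_on_def)
    also have "\<dots> = (\<Sum>t\<in>\<beta>. sh f t)"
      using \<beta>N(1) by (intro sum.cong refl) (auto simp: sh_def)
    finally show ?thesis by simp
  qed
  show thesis
  proof (rule that[OF a])
    show "(\<lambda>t. t + N) ` \<beta> \<in> Pf Npos" using \<beta>N by (auto simp: Pf_def)
    show "(\<lambda>t. t + N) ` \<beta> \<subseteq> {N<..}" using \<beta>N by fastforce
    fix P f assume "P \<in> F" "f \<in> H"
    then have "int a + poly P (int (\<Sum>t\<in>\<beta>. sh f t)) \<in> int ` A" using mem by (meson imageI)
    then show "int a + poly P (int (\<Sum>t\<in>(\<lambda>t. t + N) ` \<beta>. f t)) \<in> int ` A" unfolding sum .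
  qed
qed

text \<open>\<open>\<B>\<close> lists fibres in which a sum begins, and \<open>\<C>\<close> fibres
  together with the sums \<open>a\<close> and \<open>s\<close> reached so far. One pair
  \<open>\<alpha>\<close>, \<open>H\<close> serves all of them.\<close>

lemma Jp_extend:
  assumes q: "q \<in> Jp" "q \<oplus> q = q" and T: "T \<in> Pf Polys0" and G: "G \<in> Pf NN"
    and \<B>: "finite \<B>" "\<And>B. B \<in> \<B> \<Longrightarrow> B \<in> q"
    and \<C>: "finite \<C>" "\<And>B a s P. (B, a, s) \<in> \<C> \<Longrightarrow> P \<in> T \<Longrightarrow> int a + poly P (int s) \<in> int ` star q B"
  obtains \<alpha> H where "\<alpha> \<in> Npos" "H \<in> Pf Npos" "H \<subseteq> {N<..}"
    "\<And>B P g. B \<in> \<B> \<Longrightarrow> P \<in> T \<Longrightarrow> g \<in> G \<Longrightarrow> int \<alpha> + poly P (int (\<Sum>t\<in>H. g t)) \<in> int ` star q B"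
    "\<And>B a s P g. (B, a, s) \<in> \<C> \<Longrightarrow> P \<in> T \<Longrightarrow> g \<in> G \<Longrightarrow>
       int (a + \<alpha>) + poly P (int (s + (\<Sum>t\<in>H. g t))) \<in> int ` star q B"
proof -
  have qb: "q \<in> betaN" using q(1) by (simp add: Jp_def)
  have T': "finite T" "T \<subseteq> Polys0" "T \<noteq> {}" using T by (auto simp: Pf_def)
  \<comment> \<open>\<open>Q(x) = P(s + x) - P(s)\<close>, the increment of \<open>P\<close> at
    \<open>s\<close>, which has zero constant term.\<close>
  define Q where "Q = (\<lambda>((B :: nat set, a :: nat, s :: nat), P :: int poly).
    pcompose P [:int s, 1:] - [:poly P (int s):])"
  define Y where "Y = (\<lambda>((B, a :: nat, s :: nat), P :: int poly).
    {y \<in> Npos. nat (int a + poly P (int s)) + y \<in> star q B})"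
  define F where "F = T \<union> Q ` (\<C> \<times> T)"
  have F: "F \<in> Pf Polys0"
  proof -
    have "Q ` (\<C> \<times> T) \<subseteq> Polys0"
      by (auto simp: Q_def Polys0_def poly_pcompose simp flip: poly_0_coeff_0)
    then show ?thesis using T' \<C>(1) by (simp add: F_def Pf_def)
  qed
  have nat: "int (nat (int a + poly P (int s))) = int a + poly P (int s)"
      "nat (int a + poly P (int s)) \<in> star q B"
    if "(B, a, s) \<in> \<C>" "P \<in> T" for B a s P
    using \<C>(2)[OF that] by auto
  \<comment> \<open>The first factor is for the sums that begin, tested with \<open>P\<close>
    itself, and the second for the sums under way, tested with the increments
    \<open>Q\<close>.\<close>
  define W where "W = (Npos \<inter> (\<Inter>B\<in>\<B>. star q B)) \<inter> (Npos \<inter> (\<Inter>z\<in>\<C> \<times> T. Y z))"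
  have "W \<in> q" unfolding W_def
  proof (rule betaN_D(4)[OF qb])
    show "Npos \<inter> (\<Inter>B\<in>\<B>. star q B) \<in> q"
      by (rule betaN_Inter[OF qb \<B>(1)]) (rule star_mem[OF qb q(2) \<B>(2)])
    show "Npos \<inter> (\<Inter>z\<in>\<C> \<times> T. Y z) \<in> q"
    proof (rule betaN_Inter[OF qb])
      show "finite (\<C> \<times> T)" using \<C>(1) T'(1) by simp
      fix z assume "z \<in> \<C> \<times> T"
      then obtain B a s P where z: "z = ((B, a, s), P)" "(B, a, s) \<in> \<C>" "P \<in> T" by force
      show "Y z \<in> q"
        using star_shift[OF qb q(2) nat(2)[OF z(2,3)]] by (simp add: z(1) Y_def)
    qed
  qed
  then have "Jp_set W" using q(1) by (simp add: Jp_def)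
  then obtain \<alpha> H where \<alpha>: "\<alpha> \<in> Npos" "H \<in> Pf Npos" "H \<subseteq> {N<..}"
    and mem: "\<And>P f. P \<in> F \<Longrightarrow> f \<in> G \<Longrightarrow> int \<alpha> + poly P (int (\<Sum>t\<in>H. f t)) \<in> int ` W"
    using Jp_set_beyond[OF _ F G] by metis
  show thesis
  proof (rule that[OF \<alpha>])
    fix B P g assume "B \<in> \<B>" "P \<in> T" "g \<in> G"
    then obtain w where "w \<in> W" "int \<alpha> + poly P (int (\<Sum>t\<in>H. g t)) = int w"
      using mem[of P g] by (auto simp: F_def)
    moreover from \<open>w \<in> W\<close> have "w \<in> star q B" using \<open>B \<in> \<B>\<close> by (simp add: W_def)
    ultimately show "int \<alpha> + poly P (int (\<Sum>t\<in>H. g t)) \<in> int ` star q B" by simp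
  next
    fix B a s P g assume BP: "(B, a, s) \<in> \<C>" "P \<in> T" and g: "g \<in> G"
    define z where "z = ((B, a, s), P)"
    have z: "z \<in> \<C> \<times> T" using BP by (simp add: z_def)
    then obtain w where w: "w \<in> W" "int \<alpha> + poly (Q z) (int (\<Sum>t\<in>H. g t)) = int w"
      using mem[of "Q z" g] g by (auto simp: F_def)
    have "w \<in> Y z" using w(1) z unfolding W_def by blast
    then have "nat (int a + poly P (int s)) + w \<in> star q B" by (simp add: z_def Y_def)
    moreover have "int (a + \<alpha>) + poly P (int (s + (\<Sum>t\<in>H. g t))) = int (nat (int a + poly P (int s)) + w)"
      using w(2) nat(1)[OF BP] by (simp add: z_def Q_def poly_pcompose)
    ultimately show "int (a + \<alpha>) + poly P (int (s + (\<Sum>t\<in>H. g t))) \<in> int ` star q B"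
      by (rule image_eqI[rotated])
  qed
qed

section \<open>The tree of a member of a tensor product\<close>

text \<open>Peeling off the last coordinate of \<open>A\<close> again and again gives the levels of
  a tree. As \<open>tuples 0\<close> is the only member of \<open>tensor p 0\<close>, the root
  survives.\<close>

lemma tensor_levels:
  assumes "A \<in> tensor p m"
  obtains L where "L m = A" "L 0 = tuples 0"
    "\<And>j. j < m \<Longrightarrow> L j = {x \<in> tuples j. {y \<in> Npos. x(Suc j := y) \<in> L (Suc j)} \<in> p (Suc j)}"
  using assms
proof (induction m arbitrary: A thesis)
  case 0
  show ?case by (rule 0(1)[of "\<lambda>_. A"]) (use 0(2) in auto)
next
  case (Suc m)
  define A' where "A' = {x \<in> tuples m. {y \<in> Npos. x(Suc m := y) \<in> A} \<in> p (Suc m)}"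
  have A': "A' \<in> tensor p m" using Suc.prems(2) by (simp add: A'_def)
  obtain L where L: "L m = A'" "L 0 = tuples 0"
    "\<And>j. j < m \<Longrightarrow> L j = {x \<in> tuples j. {y \<in> Npos. x(Suc j := y) \<in> L (Suc j)} \<in> p (Suc j)}"
    by (rule Suc.IH[OF _ A']) (rule that; assumption)
  show ?case
  proof (rule Suc.prems(1)[of "L(Suc m := A)"])
    fix j assume "j < Suc m"
    then consider "j = m" | "j < m" by linarith
    then show "(L(Suc m := A)) j =
        {x \<in> tuples j. {y \<in> Npos. x(Suc j := y) \<in> (L(Suc m := A)) (Suc j)} \<in> p (Suc j)}"
    proof cases
      case 1
      then show ?thesis using L(1) by (simp add: A'_def)
    next
      case 2
      then show ?thesis using L(3)[OF 2] by simp
    qed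
  qed (use L in simp_all)
qed

locale tensor_tree =
  fixes m :: nat and p :: "nat \<Rightarrow> nat set set" and L :: "nat \<Rightarrow> (nat \<Rightarrow> nat) set" and T :: "int poly set"
  assumes m: "m \<ge> 1"
    and p: "\<And>i. i \<in> {1..m} \<Longrightarrow> p i \<in> Jp" "\<And>i. i \<in> {1..m} \<Longrightarrow> p i \<oplus> p i = p i"
    and L0: "L 0 = tuples 0"
    and L: "\<And>j. j < m \<Longrightarrow> L j = {x \<in> tuples j. {y \<in> Npos. x(Suc j := y) \<in> L (Suc j)} \<in> p (Suc j)}"
    and T: "T \<in> Pf Polys0"
begin

definition fibre :: "nat \<Rightarrow> (nat \<Rightarrow> nat) \<Rightarrow> nat set" where
  "fibre j x = {y \<in> Npos. x(Suc j := y) \<in> L (Suc j)}"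

text \<open>In a configuration \<open>(j, x, a, s)\<close> the first \<open>j\<close> coordinates \<open>x\<close> are final, while
  \<open>a\<close> and \<open>s\<close> are the partial sums of the \<open>\<alpha>\<close>'s and of the \<open>f\<close>'s for coordinate \<open>j + 1\<close>.\<close>

definition good :: "nat \<times> (nat \<Rightarrow> nat) \<times> nat \<times> nat \<Rightarrow> bool" where
  "good = (\<lambda>(j, x, a, s). j < m \<and> x \<in> L j \<and>
     (\<forall>P\<in>T. int a + poly P (int s) \<in> int ` star (p (Suc j)) (fibre j x)))"

text \<open>The value of the recursion at a set \<open>G\<close>: \<open>\<alpha>\<close> and
  \<open>H\<close> as functions of the coordinate, and the configurations whose last summand comes
  from \<open>G\<close>.\<close>

type_synonym stage = "(nat \<Rightarrow> nat) \<times> (nat \<Rightarrow> nat set) \<times> (nat \<times> (nat \<Rightarrow> nat) \<times> nat \<times> nat) set"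

definition separated :: "((nat \<Rightarrow> nat) set \<Rightarrow> stage) \<Rightarrow> (nat \<Rightarrow> nat) set \<Rightarrow> stage \<Rightarrow> bool" where
  "separated \<Phi> G = (\<lambda>(\<alpha>, H, C). \<forall>j\<in>{1..m}. \<alpha> j \<in> Npos \<and> H j \<in> Pf Npos \<and>
     (\<forall>G'\<in>Pf NN. G' \<subset> G \<longrightarrow> fst (snd (\<Phi> G')) j \<lless> H j))"

text \<open>The three ways in which \<open>G\<close> can end a chain: it begins coordinate
  \<open>1\<close>, prolongs the sum of the current coordinate, or begins the next coordinate once
  the current one is closed. \<open>G'\<close> is the set used just before.\<close>

definition step_closed :: "((nat \<Rightarrow> nat) set \<Rightarrow> stage) \<Rightarrow> (nat \<Rightarrow> nat) set \<Rightarrow> stage \<Rightarrow> bool" where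
  "step_closed \<Phi> G = (\<lambda>(\<alpha>, H, C). (\<forall>g\<in>G. (0, \<lambda>_. undefined, \<alpha> 1, \<Sum>t\<in>H 1. g t) \<in> C) \<and>
     (\<forall>G'\<in>Pf NN. G' \<subset> G \<longrightarrow> (\<forall>j x a s. (j, x, a, s) \<in> snd (snd (\<Phi> G')) \<longrightarrow> (\<forall>g\<in>G.
        (j, x, a + \<alpha> (Suc j), s + (\<Sum>t\<in>H (Suc j). g t)) \<in> C \<and>
        (Suc j < m \<longrightarrow> (\<forall>P\<in>T. (Suc j, x(Suc j := nat (int a + poly P (int s))),
            \<alpha> (Suc (Suc j)), \<Sum>t\<in>H (Suc (Suc j)). g t) \<in> C))))))"

text \<open>The condition is vacuous outside \<open>Pf NN\<close>, so that the choice can be made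
  for every set \<open>G\<close>.\<close>

definition admissible :: "((nat \<Rightarrow> nat) set \<Rightarrow> stage) \<Rightarrow> (nat \<Rightarrow> nat) set \<Rightarrow> stage \<Rightarrow> bool" where
  "admissible \<Phi> G r \<longleftrightarrow> (G \<in> Pf NN \<longrightarrow>
     separated \<Phi> G r \<and> step_closed \<Phi> G r \<and> finite (snd (snd r)) \<and> (\<forall>\<kappa>\<in>snd (snd r). good \<kappa>))"

lemma fibre_mem:
  assumes "j < m" "x \<in> L j"
  shows "fibre j x \<in> p (Suc j)"
  using assms(2)[unfolded L[OF assms(1)]] unfolding fibre_def mem_Collect_eq by (rule conjunct2)

lemma step_closed_start: "step_closed \<Phi> G (\<alpha>, H, C) \<Longrightarrow> g \<in> G \<Longrightarrow> (0, \<lambda>_. undefined, \<alpha> 1, \<Sum>t\<in>H 1. g t) \<in> C"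
  by (simp add: step_closed_def)

lemma step_closed_step:
  assumes "step_closed \<Phi> G (\<alpha>, H, C)" "G' \<in> Pf NN" "G' \<subset> G" "(j, x, a, s) \<in> snd (snd (\<Phi> G'))" "g \<in> G"
  shows "(j, x, a + \<alpha> (Suc j), s + (\<Sum>t\<in>H (Suc j). g t)) \<in> C"
    and "Suc j < m \<Longrightarrow> P \<in> T \<Longrightarrow> (Suc j, x(Suc j := nat (int a + poly P (int s))),
        \<alpha> (Suc (Suc j)), \<Sum>t\<in>H (Suc (Suc j)). g t) \<in> C"
  using assms(1)[unfolded step_closed_def prod.case, THEN conjunct2, THEN bspec, OF assms(2), THEN mp, OF assms(3),
      THEN spec, THEN spec, THEN spec, THEN spec, THEN mp, OF assms(4), THEN bspec, OF assms(5)]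
  by blast+

text \<open>The value lies in the image of a set of naturals, so \<open>nat\<close> preserves it; it
  lies in the fibre, so it can become the final coordinate \<open>j + 1\<close>.\<close>

lemma good_next:
  assumes "good (j, x, a, s)" "P \<in> T"
  shows "x(Suc j := nat (int a + poly P (int s))) \<in> L (Suc j)"
    and "int (nat (int a + poly P (int s))) = int a + poly P (int s)"
proof -
  have "int a + poly P (int s) \<in> int ` star (p (Suc j)) (fibre j x)"
    using assms by (simp add: good_def)
  then obtain n where n: "int a + poly P (int s) = int n" "n \<in> fibre j x"
    unfolding star_def by blast
  show "x(Suc j := nat (int a + poly P (int s))) \<in> L (Suc j)"
    using n(2) unfolding n(1) by (simp add: fibre_def)
  show "int (nat (int a + poly P (int s))) = int a + poly P (int s)"
    unfolding n(1) by simp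
qed

section \<open>Recursive choice over finite sets of functions\<close>

lemma admissible_exists:
  assumes IH: "\<And>G'. (G', G) \<in> finite_psubset \<Longrightarrow> admissible \<Phi> G' (\<Phi> G')"
  shows "\<exists>r. admissible \<Phi> G r"
proof (cases "G \<in> Pf NN")
  case False
  then show ?thesis by (simp add: admissible_def)
next
  case True
  then have G: "finite G" by (simp add: Pf_def)
  \<comment> \<open>A finite \<open>G\<close> has only finitely many predecessors, so only finitely
    many earlier configurations, collected in \<open>D\<close>, have to be extended.\<close>
  define S where "S = {G' \<in> Pf NN. G' \<subset> G}"
  have "S \<subseteq> Pow G" by (auto simp: S_def)
  then have finS: "finite S" using G by (meson finite_Pow_iff finite_subset)
  have S: "separated \<Phi> G' (\<Phi> G')" "finite (snd (snd (\<Phi> G')))" "\<And>\<kappa>. \<kappa> \<in> snd (snd (\<Phi> G')) \<Longrightarrow> good \<kappa>"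
    if "G' \<in> S" for G'
    using IH[of G'] that G by (auto simp: S_def admissible_def finite_psubset_def)
  define D where "D = (\<Union>G'\<in>S. snd (snd (\<Phi> G')))"
  have D: "finite D" "\<And>\<kappa>. \<kappa> \<in> D \<Longrightarrow> good \<kappa>" using finS S by (auto simp: D_def)
  have T': "finite T" using T by (simp add: Pf_def)
  define nx where "nx = (\<lambda>((j, x :: nat \<Rightarrow> nat, a, s), P). (Suc j, x(Suc j := nat (int a + poly P (int s)))))"
  \<comment> \<open>The nodes at which a new coordinate can begin: the root, and those obtained by
    closing a coordinate of an earlier configuration. Complete \<open>m\<close>-tuples are left out,
    having no fibre.\<close>
  define St where "St = insert (0, \<lambda>_. undefined) {z \<in> nx ` (D \<times> T). fst z < m}"
  have finSt: "finite St" using D T' by (simp add: St_def)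
  have St: "j < m \<and> x \<in> L j" if "(j, x) \<in> St" for j x
  proof -
    from that consider "j = 0" "x = (\<lambda>_. undefined)" | z P where "z \<in> D" "P \<in> T" "(j, x) = nx (z, P)" "j < m"
      unfolding St_def by auto
    then show ?thesis
    proof cases
      case 1
      then show ?thesis using m L0 by simp
    next
      case 2
      obtain i y a s where z: "z = (i, y, a, s)" by (cases z)
      show ?thesis using good_next(1)[OF D(2)[OF 2(1), unfolded z] 2(2)] 2(3,4) by (simp add: z nx_def)
    qed
  qed
  \<comment> \<open>The levels are treated separately; at each of them one use of
    \<open>Jp_extend\<close> serves the nodes of \<open>St\<close> and the configurations of
    \<open>D\<close>.\<close>
  have "\<exists>\<alpha> H. \<alpha> \<in> Npos \<and> H \<in> Pf Npos \<and> (\<forall>G'\<in>S. fst (snd (\<Phi> G')) (Suc j) \<lless> H) \<and>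
      (\<forall>x g. (j, x) \<in> St \<longrightarrow> g \<in> G \<longrightarrow> good (j, x, \<alpha>, \<Sum>t\<in>H. g t)) \<and>
      (\<forall>x a s g. (j, x, a, s) \<in> D \<longrightarrow> g \<in> G \<longrightarrow> good (j, x, a + \<alpha>, s + (\<Sum>t\<in>H. g t)))"
    if "j < m" for j
  proof -
    have j: "Suc j \<in> {1..m}" using that by simp
    define \<B> where "\<B> = (\<lambda>(i, x). fibre i x) ` {z \<in> St. fst z = j}"
    define \<C> where "\<C> = (\<lambda>(i, x, a, s). (fibre i x, a, s)) ` {z \<in> D. fst z = j}"
    define U where "U = (\<Union>G'\<in>S. fst (snd (\<Phi> G')) (Suc j))"
    have HS: "fst (snd (\<Phi> G')) (Suc j) \<in> Pf Npos" if "G' \<in> S" for G'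
      using S(1)[OF that] j by (auto simp: separated_def)
    then have finU: "finite U" using finS by (auto simp: U_def Pf_def)
    have \<B>: "finite \<B>" "\<And>B. B \<in> \<B> \<Longrightarrow> B \<in> p (Suc j)"
      using finSt St fibre_mem by (auto simp: \<B>_def)
    have \<C>: "finite \<C>" "\<And>B a s P. (B, a, s) \<in> \<C> \<Longrightarrow> P \<in> T \<Longrightarrow>
        int a + poly P (int s) \<in> int ` star (p (Suc j)) B"
    proof -
      show "finite \<C>" using D(1) by (simp add: \<C>_def)
      fix B a s P assume "(B, a, s) \<in> \<C>" "P \<in> T"
      then obtain x where "(j, x, a, s) \<in> D" "B = fibre j x" by (auto simp: \<C>_def)
      then show "int a + poly P (int s) \<in> int ` star (p (Suc j)) B"
        using D(2) \<open>P \<in> T\<close> by (fastforce simp: good_def)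
    qed
    \<comment> \<open>Lying beyond \<open>U\<close> puts the new set after all earlier ones of this
      coordinate. The inserted \<open>0\<close> keeps \<open>Max\<close> defined when
      \<open>G\<close> has no predecessor.\<close>
    obtain \<alpha> H where H: "\<alpha> \<in> Npos" "H \<in> Pf Npos" "H \<subseteq> {Max (insert 0 U)<..}"
      and start: "\<And>B P g. B \<in> \<B> \<Longrightarrow> P \<in> T \<Longrightarrow> g \<in> G \<Longrightarrow>
        int \<alpha> + poly P (int (\<Sum>t\<in>H. g t)) \<in> int ` star (p (Suc j)) B"
      and ext: "\<And>B a s P g. (B, a, s) \<in> \<C> \<Longrightarrow> P \<in> T \<Longrightarrow> g \<in> G \<Longrightarrow>
        int (a + \<alpha>) + poly P (int (s + (\<Sum>t\<in>H. g t))) \<in> int ` star (p (Suc j)) B"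
      by (rule Jp_extend[OF p(1)[OF j] p(2)[OF j] T True \<B> \<C>, of "Max (insert 0 U)"]) (assumption | rule that; assumption)+
    have "fst (snd (\<Phi> G')) (Suc j) \<lless> H" if "G' \<in> S" for G'
    proof -
      let ?H' = "fst (snd (\<Phi> G')) (Suc j)"
      have "?H' \<subseteq> U" using that by (auto simp: U_def)
      moreover have "finite ?H'" "?H' \<noteq> {}" using HS[OF that] by (auto simp: Pf_def)
      ultimately have "Max ?H' \<le> Max (insert 0 U)" using finU by (intro Max_mono) auto
      also have "\<dots> < Min H" using H(2,3) by (subst Min_gr_iff) (auto simp: Pf_def)
      finally show ?thesis by (simp add: set_less_def)
    qed
    moreover have "good (j, x, \<alpha>, \<Sum>t\<in>H. g t)" if x: "(j, x) \<in> St" "g \<in> G" for x g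
    proof -
      have "fibre j x \<in> \<B>" using x(1) by (force simp: \<B>_def)
      then show ?thesis using St[OF x(1)] start[OF _ _ x(2)] by (simp add: good_def)
    qed
    moreover have "good (j, x, a + \<alpha>, s + (\<Sum>t\<in>H. g t))" if x: "(j, x, a, s) \<in> D" "g \<in> G" for x a s g
    proof -
      have "(fibre j x, a, s) \<in> \<C>" using x(1) by (force simp: \<C>_def)
      then show ?thesis using D(2)[OF x(1)] ext[OF _ _ x(2)] unfolding good_def by simp
    qed
    ultimately show ?thesis using H(1,2) by blast
  qed
  then obtain \<alpha>0 H0 where *: "\<And>j. j < m \<Longrightarrow> \<alpha>0 j \<in> Npos \<and> H0 j \<in> Pf Npos \<and>
      (\<forall>G'\<in>S. fst (snd (\<Phi> G')) (Suc j) \<lless> H0 j) \<and>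
      (\<forall>x g. (j, x) \<in> St \<longrightarrow> g \<in> G \<longrightarrow> good (j, x, \<alpha>0 j, \<Sum>t\<in>H0 j. g t)) \<and>
      (\<forall>x a s g. (j, x, a, s) \<in> D \<longrightarrow> g \<in> G \<longrightarrow> good (j, x, a + \<alpha>0 j, s + (\<Sum>t\<in>H0 j. g t)))"
    by metis
  \<comment> \<open>Levels are counted from \<open>0\<close>, coordinates from
    \<open>1\<close>.\<close>
  define \<alpha> where "\<alpha> i = \<alpha>0 (i - 1)" for i
  define H where "H i = H0 (i - 1)" for i
  define C where "C = (\<lambda>((j, x), g). (j, x, \<alpha> (Suc j), \<Sum>t\<in>H (Suc j). g t)) ` (St \<times> G) \<union>
    (\<lambda>((j, x, a, s), g). (j, x, a + \<alpha> (Suc j), s + (\<Sum>t\<in>H (Suc j). g t))) ` (D \<times> G)"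
  have "separated \<Phi> G (\<alpha>, H, C)"
    unfolding separated_def prod.case
  proof (intro ballI conjI impI)
    fix i assume i: "i \<in> {1..m}"
    then have i': "i - 1 < m" "Suc (i - 1) = i" by auto
    show "\<alpha> i \<in> Npos" "H i \<in> Pf Npos" using *[OF i'(1)] by (simp_all add: \<alpha>_def H_def)
    fix G' assume "G' \<in> Pf NN" "G' \<subset> G"
    then have "G' \<in> S" by (simp add: S_def)
    then show "fst (snd (\<Phi> G')) i \<lless> H i" using *[OF i'(1)] i'(2) by (simp add: H_def)
  qed
  moreover have start: "(j, x, \<alpha> (Suc j), \<Sum>t\<in>H (Suc j). g t) \<in> C" if "(j, x) \<in> St" "g \<in> G" for j x g
    unfolding C_def by (rule UnI1, rule image_eqI[of _ _ "((j, x), g)"]) (use that in auto)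
  have ext: "(j, x, a + \<alpha> (Suc j), s + (\<Sum>t\<in>H (Suc j). g t)) \<in> C" if "(j, x, a, s) \<in> D" "g \<in> G" for j x a s g
    unfolding C_def by (rule UnI2, rule image_eqI[of _ _ "((j, x, a, s), g)"]) (use that in auto)
  have "step_closed \<Phi> G (\<alpha>, H, C)"
    unfolding step_closed_def prod.case
  proof (intro conjI ballI impI allI)
    fix g assume "g \<in> G"
    then show "(0, \<lambda>_. undefined, \<alpha> 1, \<Sum>t\<in>H 1. g t) \<in> C"
      using start[of 0 "\<lambda>_. undefined" g] by (simp add: St_def)
  next
    fix G' j x a s g assume "G' \<in> Pf NN" "G' \<subset> G" "(j, x, a, s) \<in> snd (snd (\<Phi> G'))" "g \<in> G"
    then have "(j, x, a, s) \<in> D" by (auto simp: D_def S_def)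
    then show "(j, x, a + \<alpha> (Suc j), s + (\<Sum>t\<in>H (Suc j). g t)) \<in> C" using \<open>g \<in> G\<close> by (rule ext)
    fix P assume "Suc j < m" "P \<in> T"
    have "(Suc j, x(Suc j := nat (int a + poly P (int s)))) \<in> nx ` (D \<times> T)"
      by (rule image_eqI[of _ _ "((j, x, a, s), P)"])
        (use \<open>(j, x, a, s) \<in> D\<close> \<open>P \<in> T\<close> in \<open>auto simp: nx_def\<close>)
    then have "(Suc j, x(Suc j := nat (int a + poly P (int s)))) \<in> St"
      using \<open>Suc j < m\<close> by (simp add: St_def)
    then show "(Suc j, x(Suc j := nat (int a + poly P (int s))), \<alpha> (Suc (Suc j)),
        \<Sum>t\<in>H (Suc (Suc j)). g t) \<in> C" using \<open>g \<in> G\<close> by (rule start)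
  qed
  moreover have "finite C" using finSt D(1) G by (simp add: C_def)
  moreover have "good \<kappa>" if "\<kappa> \<in> C" for \<kappa>
  proof -
    from that consider j x g where "(j, x) \<in> St" "g \<in> G" "\<kappa> = (j, x, \<alpha> (Suc j), \<Sum>t\<in>H (Suc j). g t)"
      | j x a s g where "(j, x, a, s) \<in> D" "g \<in> G" "\<kappa> = (j, x, a + \<alpha> (Suc j), s + (\<Sum>t\<in>H (Suc j). g t))"
      unfolding C_def by auto
    then show ?thesis
    proof cases
      case 1
      then show ?thesis using *[of j] St[OF 1(1)] by (simp add: \<alpha>_def H_def)
    next
      case 2
      moreover have "j < m" using D(2)[OF 2(1)] by (simp add: good_def)
      ultimately show ?thesis using *[of j] by (simp add: \<alpha>_def H_def)
    qed
  qed
  ultimately have "admissible \<Phi> G (\<alpha>, H, C)" by (simp add: admissible_def)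
  then show ?thesis by blast
qed

text \<open>Proper inclusion of finite sets is well-founded, and \<open>admissible\<close> at
  \<open>G \<in> Pf NN\<close> consults \<open>\<Phi>\<close> only at proper subsets of
  \<open>G\<close>, so dependent choice applies.\<close>

lemma admissible_choice: "\<exists>\<Phi>. \<forall>G. admissible \<Phi> G (\<Phi> G)"
proof (rule dependent_wf_choice[OF wf_finite_psubset])
  fix \<Phi> \<Psi> :: "(nat \<Rightarrow> nat) set \<Rightarrow> stage" and G r
  assume eq: "\<And>G'. (G', G) \<in> finite_psubset \<Longrightarrow> \<Phi> G' = \<Psi> G'"
  show "admissible \<Phi> G r = admissible \<Psi> G r"
  proof (cases "G \<in> Pf NN")
    case True
    then have "\<Phi> G' = \<Psi> G'" if "G' \<subset> G" for G'
      using that eq by (simp add: Pf_def finite_psubset_def)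
    then show ?thesis
      unfolding admissible_def separated_def step_closed_def by (simp cong: conj_cong)
  qed (simp add: admissible_def)
qed (rule admissible_exists)

section \<open>Configurations along an increasing chain\<close>

text \<open>Strong induction on \<open>n\<close>. Either \<open>n\<close> is the first element of
  its block, and the new sum begins at the node completed by the preceding block, or it prolongs the
  sum up to its predecessor in the block.\<close>

lemma chain_config:
  assumes \<Phi>: "\<And>G. admissible \<Phi> G (\<Phi> G)"
    and G: "\<And>n. n \<in> Npos \<Longrightarrow> G n \<in> Pf NN" "\<And>n. n \<in> Npos \<Longrightarrow> G n \<subset> G (n + 1)"
    and \<beta>: "\<And>j. j \<in> {1..m} \<Longrightarrow> \<beta> j \<in> Pf Npos" "\<And>j. j \<in> {1..<m} \<Longrightarrow> \<beta> j \<lless> \<beta> (j + 1)"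
    and f: "\<And>i. i \<in> Npos \<Longrightarrow> f i \<in> G i" and P: "\<And>j. j \<in> {1..m} \<Longrightarrow> P j \<in> T"
  defines "X \<equiv> \<lambda>j. nat (int (\<Sum>i\<in>\<beta> j. fst (\<Phi> (G i)) j) +
      poly (P j) (int (\<Sum>i\<in>\<beta> j. \<Sum>t\<in>fst (snd (\<Phi> (G i))) j. f i t)))"
  assumes j: "j < m" and n: "n \<in> \<beta> (Suc j)"
  shows "(j, restrict X {1..j}, \<Sum>i\<in>{i \<in> \<beta> (Suc j). i \<le> n}. fst (\<Phi> (G i)) (Suc j),
      \<Sum>i\<in>{i \<in> \<beta> (Suc j). i \<le> n}. \<Sum>t\<in>fst (snd (\<Phi> (G i))) (Suc j). f i t) \<in> snd (snd (\<Phi> (G n)))"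
  using j n
proof (induction n arbitrary: j rule: less_induct)
  case (less n j)
  let ?b = "\<beta> (Suc j)"
  have b: "finite ?b" "?b \<subseteq> Npos" "n \<in> Npos" using \<beta>(1)[of "Suc j"] less.prems by (auto simp: Pf_def)
  have mono: "G i \<subset> G k" if "i \<in> Npos" "i < k" for i k
  proof -
    \<comment> \<open>The chain is known to increase only from index \<open>1\<close> on, hence the
      shift.\<close>
    have "G (Suc (i - 1)) \<subset> G (Suc (k - 1))"
      by (rule lift_Suc_mono_less[of "\<lambda>n. G (Suc n)"]) (use G(2) that in auto)
    then show ?thesis using that by simp
  qed
  have clo: "step_closed \<Phi> (G n) (\<Phi> (G n))" using \<Phi>[of "G n"] G(1)[OF b(3)] by (simp add: admissible_def)
  obtain \<alpha> H C where Gn: "\<Phi> (G n) = (\<alpha>, H, C)" by (cases "\<Phi> (G n)")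
  have sum_single: "sum h {n} = h n" for h :: "nat \<Rightarrow> nat" by simp
  have fn: "f n \<in> G n" using f[OF b(3)] .
  note clo = clo[unfolded Gn]
  show ?case
  proof (cases "\<exists>k\<in>?b. k < n")
    case False
    then have single: "{i \<in> ?b. i \<le> n} = {n}" using less.prems(2) by force
    show ?thesis
    proof (cases j)
      case 0
      have "(0, \<lambda>_. undefined, \<alpha> 1, \<Sum>t\<in>H 1. f n t) \<in> C" by (rule step_closed_start[OF clo fn])
      then show ?thesis unfolding single using 0 Gn by (simp add: restrict_def)
    next
      case (Suc i)
      have i: "Suc i \<in> {1..m}" "Suc i \<in> {1..<m}" "i < m" using Suc less.prems(1) by auto
      \<comment> \<open>The sum up to the last element of the preceding block is its whole sum. As
        the blocks are ordered, this element lies below \<open>n\<close>, so the induction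
        hypothesis covers it.\<close>
      let ?k = "Max (\<beta> (Suc i))"
      have bi: "finite (\<beta> (Suc i))" "\<beta> (Suc i) \<noteq> {}" "\<beta> (Suc i) \<subseteq> Npos"
        using \<beta>(1)[OF i(1)] by (auto simp: Pf_def)
      have k: "?k \<in> \<beta> (Suc i)" using bi by simp
      have "?k < Min ?b" using \<beta>(2)[OF i(2)] Suc by (simp add: set_less_def)
      also have "Min ?b \<le> n" using b(1) less.prems(2) by (rule Min_le)
      finally have "?k < n" .
      have full: "{l \<in> \<beta> (Suc i). l \<le> ?k} = \<beta> (Suc i)" using bi by auto
      have "(i, restrict X {1..i}, \<Sum>l\<in>\<beta> (Suc i). fst (\<Phi> (G l)) (Suc i),
          \<Sum>l\<in>\<beta> (Suc i). \<Sum>t\<in>fst (snd (\<Phi> (G l))) (Suc i). f l t) \<in> snd (snd (\<Phi> (G ?k)))"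
        using less.IH[OF \<open>?k < n\<close> i(3) k] unfolding full .
      moreover have "?k \<in> Npos" using k bi(3) by blast
      moreover have "Suc i < m" "P (Suc i) \<in> T" using less.prems(1) P[OF i(1)] Suc by simp_all
      ultimately have "(Suc i, (restrict X {1..i})(Suc i := X (Suc i)), \<alpha> (Suc (Suc i)),
          \<Sum>t\<in>H (Suc (Suc i)). f n t) \<in> C"
        unfolding X_def using step_closed_step(2)[OF clo G(1) mono _ fn] \<open>?k < n\<close> by blast
      moreover have "(restrict X {1..i})(Suc i := X (Suc i)) = restrict X {1..Suc i}"
        by (auto simp: fun_eq_iff restrict_def)
      ultimately have "(Suc i, restrict X {1..Suc i}, \<alpha> (Suc (Suc i)), \<Sum>t\<in>H (Suc (Suc i)). f n t) \<in> C"
        by (simp only:)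
      then show ?thesis unfolding Suc single[unfolded Suc] by (simp only: sum_single Gn fst_conv snd_conv)
    qed
  next
    case True
    \<comment> \<open>The predecessor of \<open>n\<close> in its block; elements between
      \<open>k\<close> and \<open>n\<close> may be missing, but \<open>G k \<subset> G n\<close>
      still holds.\<close>
    define k where "k = Max {i \<in> ?b. i < n}"
    have "{i \<in> ?b. i < n} \<noteq> {}" using True by blast
    then have "k \<in> {i \<in> ?b. i < n}" unfolding k_def using b(1) by (intro Max_in) auto
    then have k: "k \<in> ?b" "k < n" by auto
    have kmax: "i \<le> k" if "i \<in> ?b" "i < n" for i
      unfolding k_def using that b(1) by (intro Max_ge) auto
    have split: "{i \<in> ?b. i \<le> n} = insert n {i \<in> ?b. i \<le> k}"
      using kmax k less.prems(2) by force
    have notin: "n \<notin> {i \<in> ?b. i \<le> k}" "finite {i \<in> ?b. i \<le> k}" using k b(1) by auto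
    have "k \<in> Npos" using k(1) b(2) by blast
    have "(j, restrict X {1..j}, (\<Sum>i\<in>{i \<in> ?b. i \<le> k}. fst (\<Phi> (G i)) (Suc j)) + \<alpha> (Suc j),
      (\<Sum>i\<in>{i \<in> ?b. i \<le> k}. \<Sum>t\<in>fst (snd (\<Phi> (G i))) (Suc j). f i t) + (\<Sum>t\<in>H (Suc j). f n t)) \<in> C"
      by (rule step_closed_step(1)[OF clo G(1) mono less.IH[OF k(2) less.prems(1) k(1)] fn]) fact+
    then show ?thesis unfolding split sum.insert[OF notin(2,1)] by (simp only: Gn fst_conv snd_conv add.commute)
  qed
qed

end

theorem corollary1p30:
  fixes m :: nat and p :: "nat \<Rightarrow> nat set set"
    and A :: "(nat \<Rightarrow> nat) set" and T :: "int poly set"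
  assumes "m \<ge> 1"
    and "(\<forall>i\<in>{1..m}. minimal_idempotent (p i)) \<or>
         (\<forall>i\<in>{1..m}. p i \<in> Jp \<and> p i \<oplus> p i = p i)"
    and "A \<in> tensor p m"
    and "T \<in> Pf Polys0"
  shows "\<exists>(\<alpha> :: nat \<Rightarrow> (nat \<Rightarrow> nat) set \<Rightarrow> nat) (H :: nat \<Rightarrow> (nat \<Rightarrow> nat) set \<Rightarrow> nat set).
    (\<forall>i\<in>{1..m}. \<alpha> i \<in> Pf NN \<rightarrow> Npos) \<and>
    (\<forall>i\<in>{1..m}. H i \<in> Pf NN \<rightarrow> Pf Npos) \<and>
    (\<forall>G \<in> Pf NN. \<forall>K \<in> Pf NN. G \<subset> K \<longrightarrow> (\<forall>i\<in>{1..m}. H i G \<lless> H i K)) \<and>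
    (\<forall>G :: nat \<Rightarrow> (nat \<Rightarrow> nat) set.
       (\<forall>n\<in>Npos. G n \<in> Pf NN \<and> G n \<subset> G (n + 1)) \<longrightarrow>
       (\<forall>(\<beta> :: nat \<Rightarrow> nat set) (f :: nat \<Rightarrow> nat \<Rightarrow> nat) (P :: nat \<Rightarrow> int poly).
          (\<forall>j\<in>{1..m}. \<beta> j \<in> Pf Npos) \<and> (\<forall>j\<in>{1..<m}. \<beta> j \<lless> \<beta> (j + 1)) \<and>
          (\<forall>i\<in>Npos. f i \<in> G i) \<and> (\<forall>j\<in>{1..m}. P j \<in> T) \<longrightarrow>
          (\<exists>x\<in>A. \<forall>j\<in>{1..m}.
             int (x j) = int (\<Sum>i\<in>\<beta> j. \<alpha> j (G i)) +
               poly (P j) (int (\<Sum>i\<in>\<beta> j. \<Sum>t\<in>H j (G i). f i t)))))"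
proof -
  obtain L where lev: "L m = A" "L 0 = tuples 0"
    "\<And>j. j < m \<Longrightarrow> L j = {x \<in> tuples j. {y \<in> Npos. x(Suc j := y) \<in> L (Suc j)} \<in> p (Suc j)}"
    by (rule tensor_levels[OF assms(3)]) (rule that; assumption)
  interpret tensor_tree m p L T
  proof
    have "p i \<in> Jp \<and> p i \<oplus> p i = p i" if i: "i \<in> {1..m}" for i
      using assms(2)
    proof
      assume "\<forall>i\<in>{1..m}. minimal_idempotent (p i)"
      then have "minimal_idempotent (p i)" using i by blast
      then show ?thesis using minimal_idempotent_Jp by (simp add: minimal_idempotent_def)
    qed (use i in blast)
    then show "p i \<in> Jp" "p i \<oplus> p i = p i" if "i \<in> {1..m}" for i
      using that by blast+
  qed (use assms lev in simp_all)
  obtain \<Phi> where "\<forall>G. admissible \<Phi> G (\<Phi> G)" using admissible_choice ..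
  then have \<Phi>: "admissible \<Phi> G (\<Phi> G)" for G ..
  let ?\<alpha> = "\<lambda>i G. fst (\<Phi> G) i" and ?H = "\<lambda>i G. fst (snd (\<Phi> G)) i"
  have sep: "?\<alpha> i G \<in> Npos \<and> ?H i G \<in> Pf Npos \<and> (\<forall>G'\<in>Pf NN. G' \<subset> G \<longrightarrow> ?H i G' \<lless> ?H i G)"
    if "G \<in> Pf NN" "i \<in> {1..m}" for G i
    using \<Phi>[of G] that unfolding admissible_def separated_def by (auto simp: case_prod_beta)
  have tuple: "\<exists>x\<in>A. \<forall>j\<in>{1..m}. int (x j) = int (\<Sum>i\<in>\<beta> j. ?\<alpha> j (G i)) +
      poly (P j) (int (\<Sum>i\<in>\<beta> j. \<Sum>t\<in>?H j (G i). f i t))"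
    if G: "\<And>n. n \<in> Npos \<Longrightarrow> G n \<in> Pf NN" "\<And>n. n \<in> Npos \<Longrightarrow> G n \<subset> G (n + 1)"
      and \<beta>: "\<And>j. j \<in> {1..m} \<Longrightarrow> \<beta> j \<in> Pf Npos" "\<And>j. j \<in> {1..<m} \<Longrightarrow> \<beta> j \<lless> \<beta> (j + 1)"
      and f: "\<And>i. i \<in> Npos \<Longrightarrow> f i \<in> G i" and P: "\<And>j. j \<in> {1..m} \<Longrightarrow> P j \<in> T"
    for G :: "nat \<Rightarrow> (nat \<Rightarrow> nat) set" and \<beta> :: "nat \<Rightarrow> nat set"
      and f :: "nat \<Rightarrow> nat \<Rightarrow> nat" and P :: "nat \<Rightarrow> int poly"
  proof -
    define a where "a j = (\<Sum>i\<in>\<beta> j. ?\<alpha> j (G i))" for j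
    define s where "s j = (\<Sum>i\<in>\<beta> j. \<Sum>t\<in>?H j (G i). f i t)" for j
    define X where "X j = nat (int (a j) + poly (P j) (int (s j)))" for j
    have good: "good (j, restrict X {1..j}, a (Suc j), s (Suc j))" if "j < m" for j
    proof -
      have b: "finite (\<beta> (Suc j))" "\<beta> (Suc j) \<noteq> {}" "\<beta> (Suc j) \<subseteq> Npos"
        using \<beta>(1)[of "Suc j"] that by (auto simp: Pf_def)
      \<comment> \<open>At the last element of the block the partial sums are the full sums.\<close>
      define n where "n = Max (\<beta> (Suc j))"
      have n: "n \<in> \<beta> (Suc j)" "{i \<in> \<beta> (Suc j). i \<le> n} = \<beta> (Suc j)" using b by (auto simp: n_def)
      have "(j, restrict X {1..j}, a (Suc j), s (Suc j)) \<in> snd (snd (\<Phi> (G n)))"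
        using chain_config[where \<Phi> = \<Phi> and G = G and \<beta> = \<beta> and f = f and P = P, OF \<Phi> G \<beta> f P that n(1)] unfolding n(2) X_def a_def s_def .
      moreover have "G n \<in> Pf NN" using G(1) n(1) b(3) by blast
      ultimately show ?thesis using \<Phi>[of "G n"] unfolding admissible_def by blast
    qed
    have "int (X j) = int (a j) + poly (P j) (int (s j))" if "j \<in> {1..m}" for j
      using good_next(2)[OF good P[OF that]] that by (cases j) (auto simp: X_def)
    moreover have "restrict X {1..m} \<in> A"
    proof -
      obtain k where k: "m = Suc k" using assms(1) by (cases m) auto
      \<comment> \<open>Closing the last coordinate leads into level \<open>m\<close> of the tree,
        which is \<open>A\<close>.\<close>
      have "(restrict X {1..k})(Suc k := X (Suc k)) \<in> L (Suc k)"
        using good_next(1)[OF good[of k] P[of "Suc k"]] unfolding X_def by (simp add: k)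
      moreover have "(restrict X {1..k})(Suc k := X (Suc k)) = restrict X {1..Suc k}"
        by (auto simp: fun_eq_iff restrict_def)
      ultimately have "restrict X {1..m} \<in> L m" unfolding k by (simp only:)
      then show ?thesis unfolding lev(1) .
    qed
    ultimately show ?thesis
      unfolding a_def[symmetric] s_def[symmetric] by (intro bexI[of _ "restrict X {1..m}"]) simp_all
  qed
  show ?thesis
  proof (rule exI[of _ ?\<alpha>], rule exI[of _ ?H], intro conjI)
    show "\<forall>i\<in>{1..m}. ?\<alpha> i \<in> Pf NN \<rightarrow> Npos" "\<forall>i\<in>{1..m}. ?H i \<in> Pf NN \<rightarrow> Pf Npos"
      using sep by (simp_all add: Pi_def)
    show "\<forall>G\<in>Pf NN. \<forall>K\<in>Pf NN. G \<subset> K \<longrightarrow> (\<forall>i\<in>{1..m}. ?H i G \<lless> ?H i K)"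
      using sep by blast
  qed (use tuple in simp)
qed

end
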